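(* Let $X$ be a Banach space which has upper $\ell^{q_0}(L^p)$-decompositions and lower $\ell^{q_1}(L^p)$-decompositions, where $p\in(1,\infty)$ and $1<q_0\le q_1<\infty$. If $T\in\mathcal{L}(X)$ is a strongly Kreiss bounded operator on $X$, then there exist constants $C,\beta>0$ depending on $X$ and $T$ such that $$\|T^n\|\le C\, n^{\frac12\left(\frac1{q_0}-\frac1{q_1}\right)}(\log(n+2))^{\beta},\qquad n\ge 1.$$
   Context: Banach spaces are over $\mathbb{C}$; $\mathcal{L}(X)$ is the space of bounded linear operators on $X$. An operator $T\in\mathcal{L}(X)$ is strongly Kreiss bounded with constant $K$ if every $\lambda\in\mathbb{C}$ with $|\lambda|>1$ is in the resolvent set of $T$ and $\|(\lambda-T)^{-n}\|\le K(|\lambda|-1)^{-n}$ for all $|\lambda|>1$ and all integers $n\ge1$; it is strongly Kreiss bounded if this holds for some $K$. Let $\mathbb{T}=[0,1]$ be the torus, $e_n(t)=e^{2\pi i n t}$, and $\widehat f(n)=\int_{\mathbb{T}}f(t)\overline{e_n(t)}\,dt$ for $f\in L^1(\mathbb{T};X)$. Let $\mathscr{P}(\mathbb{T};X)$ be the set of $X$-valued trigonometric polynomials. For an interval $I\subseteq\mathbb{Z}$ (a set of consecutive integers, possibly unbounded) and $f\in\mathscr{P}(\mathbb{T};X)$ put $D_If=\sum_{n\in I}\widehat f(n)e_n$. An interval partition is a partition $\mathcal{I}$ of $\mathbb{Z}$ into intervals. For $p,q\in[1,\infty]$, $X$ has upper $\ell^q(L^p)$-decompositions if there is $U>0$ such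 that for each interval partition $\mathcal{I}$ and all $f\in\mathscr{P}(\mathbb{T};X)$, $\|f\|_{L^p(\mathbb{T};X)}\le U\big(\sum_{I\in\mathcal{I}}\|D_If\|_{L^p(\mathbb{T};X)}^q\big)^{1/q}$; and $X$ has lower $\ell^q(L^p)$-decompositions if there is $L>0$ such that for each interval partition $\mathcal{I}$ and all $f\in\mathscr{P}(\mathbb{T};X)$, $\big(\sum_{I\in\mathcal{I}}\|D_If\|_{L^p(\mathbb{T};X)}^q\big)^{1/q}\le L\|f\|_{L^p(\mathbb{T};X)}$ (with a supremum in place of the sum when $q=\infty$). *)

theory Defs
  imports "HOL-Analysis.Analysis"
begin

section \<open>Complex Banach spaces and their bounded operators\<close>

class complex_banach = banach +
  fixes scaleC :: "complex \<Rightarrow> 'a \<Rightarrow> 'a"  (infixr \<open>*\<^sub>C\<close> 75)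
  assumes scaleC_add_right: "a *\<^sub>C (x + y) = a *\<^sub>C x + a *\<^sub>C y"
    and scaleC_add_left: "(a + b) *\<^sub>C x = a *\<^sub>C x + b *\<^sub>C x"
    and scaleC_scaleC: "a *\<^sub>C (b *\<^sub>C x) = (a * b) *\<^sub>C x"
    and scaleR_scaleC: "r *\<^sub>R x = complex_of_real r *\<^sub>C x"
    and norm_scaleC: "norm (a *\<^sub>C x) = cmod a * norm x"

definition bounded_clinear :: "('a::complex_banach \<Rightarrow> 'a) \<Rightarrow> bool" where
  "bounded_clinear T \<longleftrightarrow> bounded_linear T \<and> (\<forall>a x. T (a *\<^sub>C x) = a *\<^sub>C T x)"

definition resolvent_set :: "('a::complex_banach \<Rightarrow> 'a) \<Rightarrow> complex set" where
  "resolvent_set T = {\<mu>. \<exists>S. bounded_clinear S \<and>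
     (\<forall>x. S (\<mu> *\<^sub>C x - T x) = x) \<and> (\<forall>x. \<mu> *\<^sub>C S x - T (S x) = x)}"

text \<open>Meaningful only for \<open>\<mu>\<close> in the resolvent set, where it is the inverse of \<open>\<mu> - T\<close>.\<close>

definition resolvent :: "('a::complex_banach \<Rightarrow> 'a) \<Rightarrow> complex \<Rightarrow> 'a \<Rightarrow> 'a" where
  "resolvent T \<mu> = inv (\<lambda>x. \<mu> *\<^sub>C x - T x)"

definition strongly_Kreiss_bounded_with :: "real \<Rightarrow> ('a::complex_banach \<Rightarrow> 'a) \<Rightarrow> bool" where
  "strongly_Kreiss_bounded_with K T \<longleftrightarrow>
     (\<forall>\<mu>. cmod \<mu> > 1 \<longrightarrow> \<mu> \<in> resolvent_set T \<and>
        (\<forall>n\<ge>1. onorm (resolvent T \<mu> ^^ n) \<le> K / (cmod \<mu> - 1) ^ n))"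

definition strongly_Kreiss_bounded :: "('a::complex_banach \<Rightarrow> 'a) \<Rightarrow> bool" where
  "strongly_Kreiss_bounded T \<longleftrightarrow> (\<exists>K. strongly_Kreiss_bounded_with K T)"

section \<open>Vector-valued trigonometric polynomials\<close>

text \<open>
  Functions on the torus are represented by functions on the reals, of which only the
  values on \<open>{0..1}\<close> matter.  All integrals below are of continuous functions, so the
  Henstock--Kurzweil integral coincides with the Bochner integral (which the library provides
  only for second countable, i.e. separable, spaces).
\<close>

definition trig_char :: "int \<Rightarrow> real \<Rightarrow> complex" where
  "trig_char n t = exp (2 * complex_of_real pi * \<i> * of_int n * complex_of_real t)"

definition trig_polys :: "(real \<Rightarrow> 'a::complex_banach) set" where
  "trig_polys = {f. \<exists>F c. finite F \<and> f = (\<lambda>t. \<Sum>n\<in>F. trig_char n t *\<^sub>C c n)}"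

definition fourier_coeff :: "(real \<Rightarrow> 'a::complex_banach) \<Rightarrow> int \<Rightarrow> 'a" where
  "fourier_coeff f n = integral {0..1} (\<lambda>t. cnj (trig_char n t) *\<^sub>C f t)"

text \<open>
  For a trigonometric polynomial only finitely many coefficients are nonzero, so the
  \<open>infsum\<close>s here and in the decomposition inequalities are finite sums.
\<close>

definition freq_proj :: "int set \<Rightarrow> (real \<Rightarrow> 'a::complex_banach) \<Rightarrow> real \<Rightarrow> 'a" where
  "freq_proj I f t = (\<Sum>\<^sub>\<infinity>n\<in>I. trig_char n t *\<^sub>C fourier_coeff f n)"

definition Lp_norm :: "real \<Rightarrow> (real \<Rightarrow> 'a::complex_banach) \<Rightarrow> real" where
  "Lp_norm p f = (integral {0..1} (\<lambda>t. norm (f t) powr p)) powr (1 / p)"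

section \<open>Upper and lower decompositions\<close>

definition int_interval :: "int set \<Rightarrow> bool" where
  "int_interval I \<longleftrightarrow> (\<forall>a\<in>I. \<forall>b\<in>I. {a..b} \<subseteq> I)"

definition interval_partition :: "int set set \<Rightarrow> bool" where
  "interval_partition P \<longleftrightarrow> partition_on UNIV P \<and> (\<forall>I\<in>P. int_interval I)"

text \<open>
  Both notions are for finite exponents \<open>p, q \<ge> 1\<close>.  The \<open>itself\<close> argument carries the space,
  as in \<open>TYPE('a)\<close>.
\<close>

definition upper_decompositions :: "'a::complex_banach itself \<Rightarrow> real \<Rightarrow> real \<Rightarrow> bool" where
  "upper_decompositions _ q p \<longleftrightarrow>
     (\<exists>U>0. \<forall>P. interval_partition P \<longrightarrow> (\<forall>f \<in> (trig_polys :: (real \<Rightarrow> 'a) set).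
        Lp_norm p f \<le> U * (\<Sum>\<^sub>\<infinity>I\<in>P. Lp_norm p (freq_proj I f) powr q) powr (1 / q)))"

definition lower_decompositions :: "'a::complex_banach itself \<Rightarrow> real \<Rightarrow> real \<Rightarrow> bool" where
  "lower_decompositions _ q p \<longleftrightarrow>
     (\<exists>L>0. \<forall>P. interval_partition P \<longrightarrow> (\<forall>f \<in> (trig_polys :: (real \<Rightarrow> 'a) set).
        (\<Sum>\<^sub>\<infinity>I\<in>P. Lp_norm p (freq_proj I f) powr q) powr (1 / q) \<le> L * Lp_norm p f))"

end

theory Submission
  imports Defs
begin

text \<open>
  The strong Kreiss condition gives \<open>\<parallel>exp (z T)\<parallel> \<le> K exp \<bar>z\<bar>\<close>.  On the circle \<open>\<bar>z\<bar> = \<mu>\<close>,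
  \<open>exp (-\<mu>) exp (z T)\<close> is thus a bounded function of \<open>t\<close> whose Fourier coefficients are the
  operators \<open>T\<^sup>l\<close> with Poisson weights, concentrated on \<open>\<bar>l - \<mu>\<bar> \<lesssim> \<surd>\<mu>\<close>.  Multiplying
  \<open>\<Sum>\<^bsub>k \<le> M\<^esub> e\<^sub>k T\<^sup>k x\<close> by this function and projecting to a window of length about \<open>\<surd>\<mu>\<close> near
  \<open>\<mu>\<close> transfers an \<open>L\<^sup>p\<close> bound for the orbit from \<open>{1..M}\<close>, with \<open>M\<close> comparable to \<open>\<surd>\<mu>\<close>, to
  that window; the resulting weights have bounded variation and are removed by partial summation.

  Let \<open>A(N)\<close> be the best constant in \<open>\<parallel>\<Sum>\<^bsub>k \<le> N\<^esub> e\<^sub>k T\<^sup>k x\<parallel> \<le> A(N) \<parallel>x\<parallel>\<close>.  Cutting \<open>{1..N}\<close> into the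
  blocks \<open>[j\<^sup>2, (j + 1)\<^sup>2)\<close> and using the upper decomposition gives
  \<open>A(N) \<lesssim> N\<^bsup>1/(2 q0)\<^esup> A(10 \<surd>N)\<close>, hence \<open>A(N) \<le> N\<^bsup>1/q0\<^esup>\<close> up to a power of \<open>log N\<close>.  Dually, the lower
  decomposition bounds the best constant in
  \<open>\<parallel>\<Sum>\<^bsub>k \<le> N\<^esub> T\<^sup>k y\<^sub>k\<parallel> \<le> B(N) \<parallel>\<Sum>\<^bsub>k \<le> N\<^esub> e\<^bsub>-k\<^esub> y\<^sub>k\<parallel>\<close> by \<open>N\<^bsup>1 - 1/q1\<^esup>\<close> up to logarithms.  With
  \<open>j\<close> about \<open>\<surd>n\<close>, the identity \<open>j T\<^sup>n x = \<Sum>\<^bsub>k \<le> j\<^esub> T\<^sup>k T\<^bsup>n-k\<^esup> x\<close> and a window below \<open>n\<close> yield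
  \<open>\<parallel>T\<^sup>n\<parallel> \<lesssim> A(10 j) B(j) / j\<close>.
\<close>

section \<open>Complex scalar multiplication\<close>

lemma bounded_bilinear_scaleC:
  "bounded_bilinear (scaleC :: complex \<Rightarrow> 'a::complex_banach \<Rightarrow> 'a)"
proof
  fix a a' :: complex and b b' :: 'a and r :: real
  show "(a + a') *\<^sub>C b = a *\<^sub>C b + a' *\<^sub>C b" by (rule scaleC_add_left)
  show "a *\<^sub>C (b + b') = a *\<^sub>C b + a *\<^sub>C b'" by (rule scaleC_add_right)
  show "(r *\<^sub>R a) *\<^sub>C b = r *\<^sub>R a *\<^sub>C b"
    by (simp add: scaleR_scaleC scaleC_scaleC scaleR_conv_of_real)
  show "a *\<^sub>C r *\<^sub>R b = r *\<^sub>R a *\<^sub>C b"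
    by (simp add: scaleR_scaleC scaleC_scaleC mult.commute)
  show "\<exists>K. \<forall>a (b::'a). norm (a *\<^sub>C b) \<le> norm a * norm b * K"
    by (intro exI[of _ 1]) (simp add: norm_scaleC)
qed

interpretation scaleC: bounded_bilinear "scaleC :: complex \<Rightarrow> 'a::complex_banach \<Rightarrow> 'a"
  by (rule bounded_bilinear_scaleC)

lemma scaleC_one [simp]: "1 *\<^sub>C (x::'a::complex_banach) = x"
  using scaleR_scaleC[of 1 x] by simp

lemma bounded_clinear_funpow: "bounded_clinear T \<Longrightarrow> bounded_clinear (T ^^ n)"
  unfolding bounded_clinear_def
  by (induction n) (auto intro: bounded_linear_compose bounded_linear_ident simp: o_def id_def)

lemma onorm_funpow_le:
  fixes T :: "'a::real_normed_vector \<Rightarrow> 'a"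
  assumes "bounded_linear T"
  shows "norm ((T ^^ n) x) \<le> onorm T ^ n * norm x"
proof (induction n)
  case (Suc n)
  have "norm ((T ^^ Suc n) x) \<le> onorm T * norm ((T ^^ n) x)"
    using onorm[OF assms, of "(T ^^ n) x"] by simp
  also have "\<dots> \<le> onorm T * (onorm T ^ n * norm x)"
    by (intro mult_left_mono Suc onorm_pos_le assms)
  finally show ?case by (simp add: mult_ac)
qed simp

section \<open>Trigonometric sums\<close>

lemma trig_char_add: "trig_char (m + n) t = trig_char m t * trig_char n t"
  by (simp add: trig_char_def exp_add[symmetric] algebra_simps)

lemma trig_char_0 [simp]: "trig_char 0 t = 1"
  by (simp add: trig_char_def)

lemma norm_trig_char [simp]: "cmod (trig_char n t) = 1"
proof -
  have "trig_char n t = cis (2 * pi * of_int n * t)"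
    by (simp add: trig_char_def cis_conv_exp mult_ac)
  then show ?thesis by simp
qed

lemma cnj_trig_char: "cnj (trig_char n t) = trig_char (-n) t"
  by (simp add: trig_char_def exp_cnj)

lemma trig_char_power: "trig_char (int l) t = trig_char 1 t ^ l"
  by (simp add: trig_char_def exp_of_nat_mult[symmetric] mult_ac)

lemma continuous_on_trig_char [continuous_intros]: "continuous_on A (trig_char n)"
  unfolding trig_char_def by (intro continuous_intros)

lemma has_integral_trig_char:
  "(trig_char n has_integral (if n = 0 then 1 else 0)) {0..1}"
proof (cases "n = 0")
  case True
  then have "trig_char n = (\<lambda>t. 1)" by auto
  then show ?thesis using True has_integral_const_real[of "1::complex" 0 1] by simp
next
  case False
  define a where "a = 2 * complex_of_real pi * \<i> * of_int n"
  have a: "a \<noteq> 0" using False by (simp add: a_def)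
  have "((\<lambda>t. exp (a * complex_of_real t)) has_integral
          exp (a * complex_of_real 1) / a - exp (a * complex_of_real 0) / a) {0..1}"
  proof (rule fundamental_theorem_of_calculus)
    fix x :: real
    have "((\<lambda>z. exp (a * z) / a) has_field_derivative exp (a * complex_of_real x)) (at (complex_of_real x))"
      using a by (auto intro!: derivative_eq_intros)
    from has_vector_derivative_real_field[OF this]
    show "((\<lambda>t. exp (a * complex_of_real t) / a) has_vector_derivative exp (a * complex_of_real x))
        (at x within {0..1})" .
  qed simp
  moreover have "exp a = 1" unfolding a_def
    using exp_integer_2pi[of "of_int n"] by (simp add: mult_ac)
  moreover have "trig_char n = (\<lambda>t. exp (a * complex_of_real t))"
    by (simp add: fun_eq_iff trig_char_def a_def)
  ultimately show ?thesis using False by simp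
qed

text \<open>The frequency map \<open>\<nu>\<close> is separate from the index set and need not be
  injective, so one notion covers orbits, their reflections with frequency \<open>- int k\<close>,
  and double sums over pairs.\<close>

definition trig_sum :: "'i set \<Rightarrow> ('i \<Rightarrow> int) \<Rightarrow> ('i \<Rightarrow> 'a::complex_banach) \<Rightarrow> real \<Rightarrow> 'a" where
  "trig_sum S \<nu> y t = (\<Sum>s\<in>S. trig_char (\<nu> s) t *\<^sub>C y s)"

lemma continuous_on_trig_sum [continuous_intros]: "continuous_on A (trig_sum S \<nu> y)"
  unfolding trig_sum_def
  by (intro continuous_intros scaleC.continuous_on continuous_on_trig_char)

text \<open>This turns a convolution, which is indexed by pairs, into a polynomial with one
  coefficient per frequency.\<close>

lemma trig_sum_group:
  assumes "finite S" "finite R" "g ` S \<subseteq> R" "\<And>s. s \<in> S \<Longrightarrow> \<nu> s = \<eta> (g s)"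
  shows "trig_sum S \<nu> y = trig_sum R \<eta> (\<lambda>r. \<Sum>s\<in>{s\<in>S. g s = r}. y s)"
proof
  fix t
  have "trig_sum R \<eta> (\<lambda>r. \<Sum>s\<in>{s\<in>S. g s = r}. y s) t
      = (\<Sum>r\<in>R. \<Sum>s\<in>{s\<in>S. g s = r}. trig_char (\<nu> s) t *\<^sub>C y s)"
    unfolding trig_sum_def using assms(4) by (auto simp: scaleC.sum_right intro!: sum.cong)
  also have "\<dots> = trig_sum S \<nu> y t"
    unfolding trig_sum_def by (rule sum.group[OF assms(1-3)])
  finally show "trig_sum S \<nu> y t = trig_sum R \<eta> (\<lambda>r. \<Sum>s\<in>{s\<in>S. g s = r}. y s) t" ..
qed

lemma trig_sum_in_trig_polys:
  assumes "finite S" shows "trig_sum S \<nu> y \<in> trig_polys"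
proof -
  have "trig_sum S \<nu> y = trig_sum (\<nu> ` S) (\<lambda>n. n) (\<lambda>r. \<Sum>s\<in>{s\<in>S. \<nu> s = r}. y s)"
    using assms by (intro trig_sum_group) auto
  then show ?thesis unfolding trig_polys_def
    by (intro CollectI exI[of _ "\<nu> ` S"] exI[of _ "\<lambda>r. \<Sum>s\<in>{s\<in>S. \<nu> s = r}. y s"])
       (auto simp: trig_sum_def fun_eq_iff assms)
qed

lemma fourier_coeff_trig_sum:
  assumes "finite S"
  shows "fourier_coeff (trig_sum S \<nu> y) n = (\<Sum>s\<in>{s\<in>S. \<nu> s = n}. y s)"
proof -
  have *: "((\<lambda>t. cnj (trig_char n t) *\<^sub>C (trig_char (\<nu> s) t *\<^sub>C y s)) has_integral
          (if \<nu> s = n then y s else 0)) {0..1}" for s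
  proof -
    have "((\<lambda>t. trig_char (\<nu> s - n) t *\<^sub>C y s) has_integral
          (if \<nu> s - n = 0 then 1 else 0) *\<^sub>C y s) {0..1}"
      using has_integral_linear[OF has_integral_trig_char[of "\<nu> s - n"]
          scaleC.bounded_linear_left[of "y s"]] unfolding o_def .
    then show ?thesis
      by (auto simp: scaleC_scaleC cnj_trig_char trig_char_add[symmetric] scaleC.zero_left
          add.commute split: if_splits)
  qed
  have "((\<lambda>t. cnj (trig_char n t) *\<^sub>C trig_sum S \<nu> y t) has_integral
          (\<Sum>s\<in>S. if \<nu> s = n then y s else 0)) {0..1}"
    unfolding trig_sum_def scaleC.sum_right using * assms by (intro has_integral_sum) auto
  then show ?thesis unfolding fourier_coeff_def
    using assms by (simp add: integral_unique sum.inter_filter)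
qed

lemma freq_proj_trig_sum:
  assumes "finite S"
  shows "freq_proj I (trig_sum S \<nu> y) = trig_sum {s\<in>S. \<nu> s \<in> I} \<nu> y"
proof
  fix t
  define h where "h n = trig_char n t *\<^sub>C fourier_coeff (trig_sum S \<nu> y) n" for n
  have h: "h n = (\<Sum>s\<in>{s\<in>S. \<nu> s = n}. trig_char (\<nu> s) t *\<^sub>C y s)" for n
    unfolding h_def fourier_coeff_trig_sum[OF assms]
    by (auto simp: scaleC.sum_right intro!: sum.cong)
  have "freq_proj I (trig_sum S \<nu> y) t = infsum h I"
    unfolding freq_proj_def h_def ..
  \<comment> \<open>Only finitely many frequencies occur, so the infinite sum has finite
    support.\<close>
  also have "\<dots> = infsum h (I \<inter> \<nu> ` S)"
  proof (rule infsum_cong_neutral)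
    fix n assume "n \<in> I - I \<inter> \<nu> ` S"
    then have "{s\<in>S. \<nu> s = n} = {}" by auto
    then show "h n = 0" by (simp only: h sum.empty)
  qed auto
  also have "\<dots> = sum h (I \<inter> \<nu> ` S)" using assms by simp
  also have "\<dots> = (\<Sum>n\<in>I \<inter> \<nu> ` S. \<Sum>s\<in>{s\<in>{s\<in>S. \<nu> s \<in> I}. \<nu> s = n}. trig_char (\<nu> s) t *\<^sub>C y s)"
    unfolding h by (intro sum.cong) auto
  also have "\<dots> = trig_sum {s\<in>S. \<nu> s \<in> I} \<nu> y t"
    unfolding trig_sum_def using assms by (intro sum.group) auto
  finally show "freq_proj I (trig_sum S \<nu> y) t = trig_sum {s\<in>S. \<nu> s \<in> I} \<nu> y t" .
qed

section \<open>The \<open>L\<^sup>p\<close> norm on continuous functions\<close>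

lemma continuous_on_norm_powr:
  fixes f :: "real \<Rightarrow> 'a::real_normed_vector"
  assumes "continuous_on A f" "p > 0"
  shows "continuous_on A (\<lambda>t. norm (f t) powr p)"
  using assms by (intro continuous_on_powr' continuous_intros) auto

lemma integrable_norm_powr:
  fixes f :: "real \<Rightarrow> 'a::real_normed_vector"
  assumes "continuous_on UNIV f" "p > 0"
  shows "(\<lambda>t. norm (f t) powr p) integrable_on {0..1}"
  using assms continuous_on_subset[OF assms(1)]
  by (intro integrable_continuous_real continuous_on_norm_powr) auto

lemma Lp_norm_nonneg [simp]: "0 \<le> Lp_norm p f"
  by (simp add: Lp_norm_def)

lemma Lp_norm_powr:
  assumes "p > 0"
  shows "Lp_norm p f powr p = integral {0..1} (\<lambda>t. norm (f t) powr p)"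
proof -
  have "0 \<le> integral {0..1} (\<lambda>t. norm (f t) powr p)"
    by (cases "(\<lambda>t. norm (f t) powr p) integrable_on {0..1}")
       (auto intro: integral_nonneg simp: not_integrable_integral)
  then show ?thesis using assms by (simp add: Lp_norm_def powr_powr)
qed

lemma Lp_norm_mono:
  fixes f g :: "real \<Rightarrow> 'a::complex_banach"
  assumes "p > 0" "continuous_on UNIV f" "continuous_on UNIV g" "c \<ge> 0"
    and le: "\<And>t. norm (f t) \<le> c * norm (g t)"
  shows "Lp_norm p f \<le> c * Lp_norm p g"
proof -
  have "integral {0..1} (\<lambda>t. norm (f t) powr p) \<le> integral {0..1} (\<lambda>t. c powr p * norm (g t) powr p)"
  proof (intro integral_le integrable_norm_powr integrable_on_mult_right)
    fix t :: real
    have "norm (f t) powr p \<le> (c * norm (g t)) powr p"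
      using assms(1) le by (intro powr_mono2) auto
    then show "norm (f t) powr p \<le> c powr p * norm (g t) powr p"
      using assms(4) by (simp add: powr_mult)
  qed (use assms in auto)
  also have "\<dots> = (c * Lp_norm p g) powr p"
    using assms by (simp add: powr_mult Lp_norm_powr)
  finally have "Lp_norm p f powr p \<le> (c * Lp_norm p g) powr p"
    using assms by (simp add: Lp_norm_powr)
  then show ?thesis using assms
    by (metis Lp_norm_nonneg mult_nonneg_nonneg powr_less_mono2 not_le)
qed

lemma Lp_norm_const_norm:
  fixes f :: "real \<Rightarrow> 'a::complex_banach"
  assumes "p > 0" "\<And>t. norm (f t) = c"
  shows "Lp_norm p f = c"
proof -
  have "c \<ge> 0" using assms(2)[of 0] by (metis norm_ge_zero)
  then show ?thesis using assms by (simp add: Lp_norm_def powr_powr)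
qed

text \<open>For positive arguments this is \<open>powr_convex\<close>; if one argument is 0 it
  reduces to t^p \<le> t for t in [0,1].\<close>

lemma convex_on_powr_nonneg:
  assumes "p \<ge> (1::real)"
  shows "convex_on {0..} (\<lambda>x. x powr p)"
proof (rule convex_onI)
  fix t x y :: real
  assume t: "0 < t" "t < 1" and xy: "x \<in> {0..}" "y \<in> {0..}"
  have le: "s powr p \<le> s" if "0 \<le> s" "s \<le> 1" for s :: real
    using powr_mono'[of 1 p s] that assms by simp
  show "((1 - t) *\<^sub>R x + t *\<^sub>R y) powr p \<le> (1 - t) * x powr p + t * y powr p"
  proof (cases "x = 0 \<or> y = 0")
    case True
    then show ?thesis using t xy le[of t] le[of "1 - t"]
      by (auto simp: powr_mult intro!: mult_right_mono)
  next
    case False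
    then show ?thesis
      using convex_onD[OF powr_convex[OF assms], of t x y] t xy by auto
  qed
qed simp

text \<open>Minkowski's inequality by convexity: |f| + |g| is a + b times the convex combination of
  |f|/a and |g|/b with weights a/(a+b) and b/(a+b), and x^p is convex.\<close>

lemma Lp_norm_triangle:
  fixes f g :: "real \<Rightarrow> 'a::complex_banach"
  assumes p: "p \<ge> 1" and c: "continuous_on UNIV f" "continuous_on UNIV g"
  shows "Lp_norm p (\<lambda>t. f t + g t) \<le> Lp_norm p f + Lp_norm p g"
proof (rule field_le_epsilon)
  fix e :: real assume e: "e > 0"
  \<comment> \<open>The summand \<open>e/2\<close> keeps both denominators positive when a norm
    vanishes.\<close>
  define a b where "a = Lp_norm p f + e/2" and "b = Lp_norm p g + e/2"
  have ab: "a > 0" "b > 0" using e Lp_norm_nonneg[of p f] Lp_norm_nonneg[of p g]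
    unfolding a_def b_def by linarith+
  define s where "s = b / (a + b)"
  have s: "0 \<le> s" "s \<le> 1" "1 - s = a / (a + b)" using ab by (auto simp: s_def field_simps)
  have pt: "norm (f t + g t) powr p \<le>
      (a + b) powr p * ((1 - s) / a powr p * norm (f t) powr p + s / b powr p * norm (g t) powr p)" for t
  proof -
    have "norm (f t + g t) powr p \<le> (norm (f t) + norm (g t)) powr p"
      using p by (intro powr_mono2 norm_triangle_ineq) auto
    also have "norm (f t) + norm (g t) = (a + b) * ((1 - s) *\<^sub>R (norm (f t) / a) + s *\<^sub>R (norm (g t) / b))"
    proof -
      have "(1 - s) * (norm (f t) / a) = norm (f t) / (a + b)"
        "s * (norm (g t) / b) = norm (g t) / (a + b)"
        unfolding s(3) using ab by (simp_all add: s_def)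
      then show ?thesis using ab by (simp add: add_divide_distrib[symmetric])
    qed
    also have "\<dots> powr p = (a + b) powr p * ((1 - s) *\<^sub>R (norm (f t) / a) + s *\<^sub>R (norm (g t) / b)) powr p"
      using ab s by (simp add: powr_mult)
    also have "\<dots> \<le> (a + b) powr p * ((1 - s) * (norm (f t) / a) powr p + s * (norm (g t) / b) powr p)"
      using ab s by (intro mult_left_mono convex_onD[OF convex_on_powr_nonneg[OF p]]) auto
    finally show ?thesis using ab by (simp add: powr_divide)
  qed
  have le: "integral {0..1} (\<lambda>t. norm (f t) powr p) \<le> a powr p"
     "integral {0..1} (\<lambda>t. norm (g t) powr p) \<le> b powr p"
    using p e by (auto simp: a_def b_def simp flip: Lp_norm_powr intro!: powr_mono2)
  have i: "(\<lambda>t. norm (f t) powr p) integrable_on {0..1}" "(\<lambda>t. norm (g t) powr p) integrable_on {0..1}"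
    using p c by (auto intro!: integrable_norm_powr)
  have "Lp_norm p (\<lambda>t. f t + g t) powr p = integral {0..1} (\<lambda>t. norm (f t + g t) powr p)"
    using p by (simp add: Lp_norm_powr)
  also have "\<dots> \<le> integral {0..1} (\<lambda>t. (a + b) powr p *
      ((1 - s) / a powr p * norm (f t) powr p + s / b powr p * norm (g t) powr p))"
    using p c i by (intro integral_le integrable_norm_powr pt integrable_on_mult_right
        integrable_add continuous_on_add) auto
  also have "\<dots> = (a + b) powr p * ((1 - s) / a powr p * integral {0..1} (\<lambda>t. norm (f t) powr p)
       + s / b powr p * integral {0..1} (\<lambda>t. norm (g t) powr p))"
    using i by (simp only: integral_mult_right integral_add integrable_on_mult_right)
  also have "\<dots> \<le> (a + b) powr p * ((1 - s) / a powr p * a powr p + s / b powr p * b powr p)"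
    using ab s le by (intro mult_left_mono add_mono) auto
  also have "\<dots> = (a + b) powr p" using ab by simp
  finally have "Lp_norm p (\<lambda>t. f t + g t) \<le> a + b"
    using ab p by (metis add_pos_pos less_le_not_le linorder_not_less powr_less_mono2 less_le_trans zero_less_one)
  then show "Lp_norm p (\<lambda>t. f t + g t) \<le> Lp_norm p f + Lp_norm p g + e"
    by (simp add: a_def b_def)
qed

lemma Lp_norm_scaleC:
  fixes f :: "real \<Rightarrow> 'a::complex_banach"
  assumes "p > 0" "continuous_on UNIV f"
  shows "Lp_norm p (\<lambda>t. a *\<^sub>C f t) \<le> cmod a * Lp_norm p f"
  using assms
  by (intro Lp_norm_mono scaleC.continuous_on continuous_intros) (auto simp: norm_scaleC)

lemma Lp_norm_sum:
  fixes f :: "'i \<Rightarrow> real \<Rightarrow> 'a::complex_banach"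
  assumes "p \<ge> 1" "finite A" "\<And>i. i \<in> A \<Longrightarrow> continuous_on UNIV (f i)"
  shows "Lp_norm p (\<lambda>t. \<Sum>i\<in>A. f i t) \<le> (\<Sum>i\<in>A. Lp_norm p (f i))"
  using assms(2,3)
proof (induction A rule: finite_induct)
  case empty
  then show ?case using assms(1) by (simp add: Lp_norm_const_norm)
next
  case (insert i A)
  have "Lp_norm p (\<lambda>t. f i t + (\<Sum>i\<in>A. f i t)) \<le> Lp_norm p (f i) + Lp_norm p (\<lambda>t. \<Sum>i\<in>A. f i t)"
    by (intro Lp_norm_triangle assms(1) continuous_on_sum insert.prems) auto
  then show ?case using insert by fastforce
qed

section \<open>Exponential bounds from the strong Kreiss condition\<close>

text \<open>Newton's binomial series with exponent -n.\<close>

lemma negative_binomial_sums: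
  fixes r :: real
  assumes "0 \<le> r" "r < 1"
  shows "(\<lambda>k. real ((n + k - 1) choose k) * r ^ k) sums (1 / (1 - r) ^ n)"
proof -
  have "(\<lambda>k. ((- real n) gchoose k) * (-r) ^ k) sums (1 + (-r)) powr (- real n)"
    using assms by (intro gen_binomial_real) auto
  moreover have "((- real n) gchoose k) * (-r) ^ k = real ((n + k - 1) choose k) * r ^ k" for k
  proof -
    have "(real n + real k - 1) gchoose k = real ((n + k - 1) choose k)"
    \<comment> \<open>For n = k = 0 the real n + k - 1 is -1 while natural subtraction gives 0; both
      binomial coefficients are 1 there, but the arguments differ.\<close>
    proof (cases "k = 0")
      case False
      then have "real n + real k - 1 = real (n + k - 1)" by linarith
      then show ?thesis by (simp only: binomial_gbinomial)
    qed simp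
    moreover have "(- 1) ^ k * (- r) ^ k = (- 1 * - r) ^ k"
      by (rule power_mult_distrib[symmetric])
    ultimately show ?thesis
      unfolding gbinomial_minus[of "real n" k] by (simp only: mult_ac) simp
  qed
  moreover have "(1 + (-r)) powr (- real n) = 1 / (1 - r) ^ n"
    using assms powr_realpow[of "1 - r" n] by (simp add: powr_minus inverse_eq_divide)
  ultimately show ?thesis by simp
qed

text \<open>The binomial coefficient is n(n+1)...(n+k-1)/k!, hence at least n^k/k!. Thus the series
  of (1 - a/n)^(-n) dominates that of exp(a) coefficientwise.\<close>

lemma inverse_fact_le_binomial:
  assumes "n \<ge> 1"
  shows "1 / fact k \<le> real ((n + k - 1) choose k) / real n ^ k"
proof (induction k)
  case (Suc k)
  have "Suc k * ((n + k) choose Suc k) = (n + k) * ((n + k - 1) choose k)"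
    using Suc_times_binomial_eq[of "n + k - 1" k] assms by (simp add: mult.commute)
  then have eq: "real ((n + k) choose Suc k) = real (n + k) * real ((n + k - 1) choose k) / real (Suc k)"
    by (simp add: field_simps flip: of_nat_mult of_nat_add)
  have "1 / fact (Suc k) = 1 / real (Suc k) * (1 / fact k)"
    by (simp add: field_simps)
  also have "\<dots> \<le> 1 / real (Suc k) * (real ((n + k - 1) choose k) / real n ^ k)"
    using Suc by (intro mult_left_mono) auto
  also have "\<dots> \<le> (real (n + k) / real n) * (1 / real (Suc k) * (real ((n + k - 1) choose k) / real n ^ k))"
  proof -
    have "1 * c \<le> (real (n + k) / real n) * c" if "c \<ge> 0" for c
      using assms that by (intro mult_right_mono) auto
    from this[of "1 / real (Suc k) * (real ((n + k - 1) choose k) / real n ^ k)"]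
    show ?thesis by simp
  qed
  also have "\<dots> = real ((n + Suc k - 1) choose Suc k) / real n ^ Suc k"
    using eq by simp
  finally show ?case .
qed simp

text \<open>The series represents (I - S)^(-n) x. By induction on n: applying I - S once lowers the
  exponent by one. Geometric decay along the orbit of the single vector x suffices for
  convergence.\<close>

lemma negative_binomial_series_inverse:
  fixes S :: "'a::banach \<Rightarrow> 'a"
  assumes S: "bounded_linear S" and r: "0 \<le> r" "r < 1"
    and bound: "\<And>k. norm ((S ^^ k) x) \<le> r ^ k * norm x"
  shows "((\<lambda>v. v - S v) ^^ n) (\<Sum>k. real ((n + k - 1) choose k) *\<^sub>R (S ^^ k) x) = x"
proof (induction n)
  case 0
  have "(\<lambda>k. real ((0 + k - 1) choose k) *\<^sub>R (S ^^ k) x) = (\<lambda>k. if k = 0 then x else 0)"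
    by (auto simp: fun_eq_iff)
  then show ?case using sums_unique[OF sums_single[of 0 "\<lambda>_. x"]] by simp
next
  case (Suc n)
  define b where "b n k = real ((n + k - 1) choose k)" for n k
  have sm: "summable (\<lambda>k. b n k *\<^sub>R (S ^^ k) x)" for n
  proof (rule summable_comparison_test')
    show "summable (\<lambda>k. b n k * r ^ k * norm x)"
      unfolding b_def using sums_summable[OF negative_binomial_sums[OF r]]
      by (intro summable_mult2)
    show "norm (b n k *\<^sub>R (S ^^ k) x) \<le> b n k * r ^ k * norm x" for k
      using mult_left_mono[OF bound[of k], of "b n k"] by (simp add: b_def mult.assoc)
  qed
  define N where "N n = (\<Sum>k. b n k *\<^sub>R (S ^^ k) x)" for n
  have "S (N (Suc n)) = (\<Sum>k. b (Suc n) k *\<^sub>R (S ^^ Suc k) x)"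
    unfolding N_def bounded_linear.suminf[OF S sm[of "Suc n"]]
    by (simp add: linear_scale bounded_linear.linear[OF S])
  moreover have sm': "summable (\<lambda>k. b (Suc n) k *\<^sub>R (S ^^ Suc k) x)"
    using bounded_linear.summable[OF S sm[of "Suc n"]]
    by (simp add: linear_scale bounded_linear.linear[OF S])
  moreover have "N m = x + (\<Sum>k. b m (Suc k) *\<^sub>R (S ^^ Suc k) x)" for m
    using suminf_split_head[OF sm[of m]] by (simp add: N_def b_def)
  \<comment> \<open>Pascal's rule.\<close>
  moreover have "b (Suc n) (Suc k) *\<^sub>R (S ^^ Suc k) x - b (Suc n) k *\<^sub>R (S ^^ Suc k) x
      = b n (Suc k) *\<^sub>R (S ^^ Suc k) x" for k
    unfolding b_def by (simp flip: scaleR_left_diff_distrib)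
  moreover have "summable (\<lambda>k. b (Suc n) (Suc k) *\<^sub>R (S ^^ Suc k) x)"
    using sm[of "Suc n"] by (subst summable_Suc_iff)
  ultimately have "N (Suc n) - S (N (Suc n)) = N n"
    by (simp add: suminf_diff del: funpow.simps)
  then show ?case using Suc
    by (simp add: N_def b_def funpow_Suc_right del: funpow.simps)
qed

text \<open>The resolvent at \<mu> is 1/\<mu> times the inverse of I - T/\<mu>. Stated as a lower
  bound for (I - T/\<mu>)^n, the Kreiss estimate applies directly to a vector whose image is
  known.\<close>

lemma Kreiss_resolvent_power_bound:
  fixes T :: "'a::complex_banach \<Rightarrow> 'a"
  assumes T: "bounded_clinear T" and K: "strongly_Kreiss_bounded_with K T"
    and \<mu>: "cmod \<mu> > 1" and n: "n \<ge> 1"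
  shows "norm y \<le> K / (1 - 1 / cmod \<mu>) ^ n * norm (((\<lambda>v. v - (1 / \<mu>) *\<^sub>C T v) ^^ n) y)"
proof -
  have \<mu>0: "\<mu> \<noteq> 0" using \<mu> by auto
  obtain S where S: "bounded_clinear S" "\<And>x. S (\<mu> *\<^sub>C x - T x) = x" "\<And>x. \<mu> *\<^sub>C S x - T (S x) = x"
    using K \<mu> unfolding strongly_Kreiss_bounded_with_def resolvent_set_def by blast
  have "resolvent T \<mu> = S"
    unfolding resolvent_def using S(2,3) by (intro inv_equality) auto
  then have on: "onorm (S ^^ n) \<le> K / (cmod \<mu> - 1) ^ n"
    using K \<mu> n unfolding strongly_Kreiss_bounded_with_def by auto
  have Sn: "bounded_linear (S ^^ n)"
    using bounded_clinear_funpow[OF S(1)] by (simp add: bounded_clinear_def)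
  let ?D = "\<lambda>v. v - (1 / \<mu>) *\<^sub>C T v"
  have D: "S (\<mu> *\<^sub>C ?D v) = v" for v
    using S(2) \<mu>0 by (simp add: scaleC.diff_right scaleC_scaleC)
  have SC: "S (a *\<^sub>C v) = a *\<^sub>C S v" for a v using S(1) by (simp add: bounded_clinear_def)
  have "(S ^^ n) (\<mu> ^ n *\<^sub>C (?D ^^ n) y) = y" for n
  proof (induction n)
    case (Suc n)
    have "(S ^^ Suc n) (\<mu> ^ Suc n *\<^sub>C (?D ^^ Suc n) y) = (S ^^ n) (S (\<mu> ^ n *\<^sub>C \<mu> *\<^sub>C ?D ((?D ^^ n) y)))"
      by (simp add: funpow_swap1 scaleC_scaleC mult.commute)
    also have "\<dots> = (S ^^ n) (\<mu> ^ n *\<^sub>C (?D ^^ n) y)"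
      by (subst SC, subst D) simp
    finally show ?case using Suc by simp
  qed simp
  then have "norm y \<le> onorm (S ^^ n) * norm (\<mu> ^ n *\<^sub>C (?D ^^ n) y)"
    using onorm[OF Sn, of "\<mu> ^ n *\<^sub>C (?D ^^ n) y"] by simp
  also have "\<dots> \<le> K / (cmod \<mu> - 1) ^ n * (cmod \<mu> ^ n * norm ((?D ^^ n) y))"
    unfolding norm_scaleC norm_power using on by (intro mult_right_mono) auto
  also have "\<dots> = K / (1 - 1 / cmod \<mu>) ^ n * norm ((?D ^^ n) y)"
  proof -
      have "1 - 1 / cmod \<mu> = (cmod \<mu> - 1) / cmod \<mu>"
      using \<mu>0 by (simp add: diff_divide_distrib)
    then have "(1 - 1 / cmod \<mu>) ^ n = (cmod \<mu> - 1) ^ n / cmod \<mu> ^ n"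
      by (simp only: power_divide)
    then show ?thesis by simp
  qed
  finally show ?thesis .
qed

text \<open>exp(zT) is the limit of (I - zT/n)^(-n). The Kreiss condition at n/z bounds these
  operators by K (1 - |z|/n)^(-n), which tends to K exp(|z|). With s = |z| times the norm of T, the
  error is at most (1 - s/n)^(-n) - exp(s), which tends to 0.\<close>

lemma strongly_Kreiss_bounded_exp_series:
  fixes T :: "'a::complex_banach \<Rightarrow> 'a"
  assumes T: "bounded_clinear T" and K: "strongly_Kreiss_bounded_with K T" and z: "z \<noteq> 0"
  shows "norm (\<Sum>k. (z ^ k / fact k) *\<^sub>C (T ^^ k) x) \<le> K * exp (cmod z) * norm x"
proof -
  have bl: "bounded_linear T" using T by (simp add: bounded_clinear_def)
  define \<tau> where "\<tau> = onorm T"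
  have \<tau>: "\<tau> \<ge> 0" unfolding \<tau>_def by (rule onorm_pos_le[OF bl])
  define s where "s = cmod z * \<tau>"
  have s: "s \<ge> 0" using \<tau> by (simp add: s_def)
  have Tk: "norm (z ^ k *\<^sub>C (T ^^ k) x) \<le> s ^ k * norm x" for k
    using onorm_funpow_le[OF bl, of k x] mult_left_mono[of _ _ "cmod z ^ k"]
    by (simp add: norm_scaleC norm_power s_def \<tau>_def power_mult_distrib mult.assoc)
  define E where "E = (\<Sum>k. (z ^ k / fact k) *\<^sub>C (T ^^ k) x)"
  have exps: "(\<lambda>k. s ^ k / fact k) sums exp s"
    using exp_converges[of s] by (simp add: field_simps)
  have smE: "summable (\<lambda>k. (z ^ k / fact k) *\<^sub>C (T ^^ k) x)"
  proof (rule summable_comparison_test')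
    show "summable (\<lambda>k. s ^ k / fact k * norm x)"
      using exps by (intro summable_mult2) (rule sums_summable)
    show "norm ((z ^ k / fact k) *\<^sub>C (T ^^ k) x) \<le> s ^ k / fact k * norm x" for k
      using divide_right_mono[OF Tk[of k], of "fact k"]
      by (simp add: norm_scaleC norm_divide)
  qed
  have *: "norm E \<le> (K / (1 - cmod z / n) ^ n + (1 / (1 - s / n) ^ n - exp s)) * norm x"
    if n: "real n > cmod z" "real n > s" "n \<ge> 1" for n :: nat
  proof -
    define S where "S v = (z / n) *\<^sub>C T v" for v
    define b where "b k = real ((n + k - 1) choose k)" for k
    have Sk: "(S ^^ k) v = (z / n) ^ k *\<^sub>C (T ^^ k) v" for k v
    proof (induction k)
      case (Suc k)
      then show ?case using T by (simp add: S_def bounded_clinear_def scaleC_scaleC)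
    qed simp
    have bS: "bounded_linear S" unfolding S_def
      by (rule bounded_linear_compose[OF scaleC.bounded_linear_right bl])
    have nSk: "norm ((S ^^ k) x) \<le> (s / n) ^ k * norm x" for k
      using divide_right_mono[OF Tk[of k], of "real n ^ k"]
      by (simp add: Sk norm_scaleC norm_divide power_divide norm_power)
    have r: "0 \<le> s / n" "s / n < 1" using n s by auto
    have bs: "(\<lambda>k. b k * (s / n) ^ k) sums (1 / (1 - s / n) ^ n)"
      unfolding b_def by (rule negative_binomial_sums[OF r])
    define N where "N = (\<Sum>k. b k *\<^sub>R (S ^^ k) x)"
    have smN: "summable (\<lambda>k. b k *\<^sub>R (S ^^ k) x)"
    proof (rule summable_comparison_test')
      show "summable (\<lambda>k. b k * (s / n) ^ k * norm x)"
        using sums_summable[OF bs] by (intro summable_mult2)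
      show "norm (b k *\<^sub>R (S ^^ k) x) \<le> b k * (s / n) ^ k * norm x" for k
        using mult_left_mono[OF nSk[of k], of "b k"] by (simp add: b_def mult.assoc)
    qed
    have "((\<lambda>v. v - S v) ^^ n) N = x"
      unfolding N_def b_def by (rule negative_binomial_series_inverse[OF bS r nSk])
    moreover have "cmod (n / z) > 1" using n z by (simp add: norm_divide)
    ultimately have nN: "norm N \<le> K / (1 - cmod z / n) ^ n * norm x"
      using Kreiss_resolvent_power_bound[OF T K, of "n / z" n N] n
      by (simp add: S_def norm_divide)
    have "norm (N - E) \<le> (1 / (1 - s / n) ^ n - exp s) * norm x"
    proof -
      have sl: "(\<lambda>k. b k *\<^sub>R (S ^^ k) x - (z ^ k / fact k) *\<^sub>C (T ^^ k) x) sums (N - E)"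
        unfolding N_def E_def using smN smE by (intro sums_diff summable_sums)
      moreover have sr: "(\<lambda>k. (b k * (s / n) ^ k - s ^ k / fact k) * norm x)
          sums ((1 / (1 - s / n) ^ n - exp s) * norm x)"
        using bs exps by (intro sums_mult2 sums_diff)
      moreover have "norm (b k *\<^sub>R (S ^^ k) x - (z ^ k / fact k) *\<^sub>C (T ^^ k) x)
          \<le> (b k * (s / n) ^ k - s ^ k / fact k) * norm x" for k
      proof -
        \<comment> \<open>Because the coefficients of the difference are nonnegative, the scalar
          majorant is itself a difference of two series with known sums.\<close>
        have c: "0 \<le> b k / n ^ k - 1 / fact k"
          using inverse_fact_le_binomial[of n k] n by (simp add: b_def)
        have "b k *\<^sub>R (S ^^ k) x - (z ^ k / fact k) *\<^sub>C (T ^^ k) x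
            = (b k / n ^ k - 1 / fact k) *\<^sub>R z ^ k *\<^sub>C (T ^^ k) x"
          by (simp add: Sk scaleR_scaleC scaleC_scaleC power_divide of_real_diff
              left_diff_distrib flip: scaleC.diff_left)
        then have "norm (b k *\<^sub>R (S ^^ k) x - (z ^ k / fact k) *\<^sub>C (T ^^ k) x)
            \<le> (b k / n ^ k - 1 / fact k) * (s ^ k * norm x)"
          using mult_left_mono[OF Tk[of k] c] c by simp
        then show ?thesis by (simp add: power_divide algebra_simps)
      qed
      ultimately show ?thesis
        unfolding sums_unique[OF sl] sums_unique[OF sr]
        by (intro norm_suminf_le sums_summable[OF sr])
    qed
    then show ?thesis using nN norm_triangle_ineq4[of N "N - E"] by (simp add: algebra_simps)
  qed
  have lim: "(\<lambda>n. 1 / (1 - a / real n) ^ n) \<longlonglongrightarrow> exp a" for a :: real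
  proof -
    have "(\<lambda>n. 1 / (1 + (-a) / real n) ^ n) \<longlonglongrightarrow> 1 / exp (-a)"
      by (intro tendsto_divide tendsto_exp_limit_sequentially tendsto_const) simp
    then show ?thesis by (simp add: exp_minus divide_inverse)
  qed
  have "norm E \<le> (K * exp (cmod z) + (exp s - exp s)) * norm x"
  proof (rule tendsto_lowerbound)
    show "(\<lambda>n. (K * (1 / (1 - cmod z / real n) ^ n) + (1 / (1 - s / real n) ^ n - exp s)) * norm x)
        \<longlonglongrightarrow> (K * exp (cmod z) + (exp s - exp s)) * norm x"
      by (intro tendsto_intros lim)
    obtain m :: nat where m: "max (max (cmod z) s) 1 < real m" using reals_Archimedean2 by blast
    show "eventually (\<lambda>n. norm E \<le> (K * (1 / (1 - cmod z / real n) ^ n)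
        + (1 / (1 - s / real n) ^ n - exp s)) * norm x) sequentially"
      using eventually_ge_at_top[of m]
    proof eventually_elim
      case (elim n)
      then have "real m \<le> real n" by simp
      with m have "real n > cmod z" "real n > s" "n \<ge> 1" by auto
      from *[OF this] show ?case by simp
    qed
  qed simp
  then show ?thesis by (simp add: E_def)
qed

section \<open>Poisson-weighted powers of the operator as bounded multipliers on the circle\<close>

definition poisson_weight :: "real \<Rightarrow> nat \<Rightarrow> real" where
  "poisson_weight \<mu> l = exp (-\<mu>) * \<mu> ^ l / fact l"

lemma poisson_weight_nonneg [simp]: "\<mu> \<ge> 0 \<Longrightarrow> 0 \<le> poisson_weight \<mu> l"
  by (simp add: poisson_weight_def)

text \<open>For z = \<mu> e_1(t) the sum is a truncation of exp(-\<mu>) exp(zT) x. Truncating keeps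
  everything a trigonometric polynomial, and the threshold is uniform in t and x because the tail is
  dominated by that of the scalar exponential series at \<mu> times the norm of T.\<close>

lemma poisson_multiplier_bound:
  fixes T :: "'a::complex_banach \<Rightarrow> 'a"
  assumes T: "bounded_clinear T" and K: "strongly_Kreiss_bounded_with K T" and \<mu>: "\<mu> \<ge> 0"
  shows "\<exists>m0. \<forall>m\<ge>m0. \<forall>t x.
     norm (\<Sum>l\<le>m. trig_char (int l) t *\<^sub>C poisson_weight \<mu> l *\<^sub>R (T ^^ l) x) \<le> (\<bar>K\<bar> + 2) * norm x"
\<comment> \<open>The exponential bound uses the resolvent at n/z, so it requires z \<noteq> 0. For
  \<mu> = 0 only the term l = 0 survives.\<close>
proof (cases "\<mu> = 0")
  case True
  have "(\<Sum>l\<le>m. trig_char (int l) t *\<^sub>C poisson_weight \<mu> l *\<^sub>R (T ^^ l) x) = x" for m t x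
  proof -
    have "(\<Sum>l\<le>m. trig_char (int l) t *\<^sub>C poisson_weight \<mu> l *\<^sub>R (T ^^ l) x)
        = (\<Sum>l\<in>{0}. trig_char (int l) t *\<^sub>C poisson_weight \<mu> l *\<^sub>R (T ^^ l) x)"
      using True
      by (intro sum.mono_neutral_right) (auto simp: poisson_weight_def scaleC.zero_right power_0_left)
    also have "\<dots> = x" using True by (simp add: poisson_weight_def)
    finally show ?thesis .
  qed
  moreover have "1 * norm x \<le> (\<bar>K\<bar> + 2) * norm x" for x :: 'a by (intro mult_right_mono) auto
  ultimately show ?thesis by auto
next
  case False
  with \<mu> have \<mu>0: "\<mu> > 0" by simp
  have bl: "bounded_linear T" using T by (simp add: bounded_clinear_def)
  define s where "s = \<mu> * onorm T"
  have s: "s \<ge> 0" using \<mu> onorm_pos_le[OF bl] by (simp add: s_def)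
  have exps: "summable (\<lambda>k. s ^ k / fact k)"
    using exp_converges[of s] by (auto simp: field_simps dest: sums_summable)
  from order_tendstoD(2)[OF suminf_exist_split2[OF exps], of 1]
  obtain m0 where m0: "\<And>m. m \<ge> m0 \<Longrightarrow> (\<Sum>k. s ^ (k + m) / fact (k + m)) < 1"
    by (auto simp: eventually_sequentially)
  show ?thesis
  proof (intro exI[of _ m0] allI impI)
    fix m t and x :: 'a assume m: "m \<ge> m0"
    define z where "z = of_real \<mu> * trig_char 1 t"
    have z: "cmod z = \<mu>" using \<mu>0 by (simp add: z_def norm_mult)
    then have z0: "z \<noteq> 0" using \<mu>0 by auto
    define f where "f k = (z ^ k / fact k) *\<^sub>C (T ^^ k) x" for k
    have nf: "norm (f k) \<le> s ^ k / fact k * norm x" for k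
    proof -
      have "norm (f k) = \<mu> ^ k / fact k * norm ((T ^^ k) x)"
        by (simp add: f_def norm_scaleC norm_divide norm_power z)
      also have "\<dots> \<le> \<mu> ^ k / fact k * (onorm T ^ k * norm x)"
        using \<mu> by (intro mult_left_mono onorm_funpow_le bl) auto
      finally show ?thesis by (simp add: s_def power_mult_distrib)
    qed
    have smf: "summable f"
      by (rule summable_comparison_test'[OF summable_mult2[OF exps, of "norm x"]]) (rule nf)
    have tail: "norm (\<Sum>k. f (k + Suc m)) \<le> norm x"
    proof -
      have "norm (\<Sum>k. f (k + Suc m)) \<le> (\<Sum>k. s ^ (k + Suc m) / fact (k + Suc m) * norm x)"
        using nf exps by (intro norm_suminf_le summable_mult2 summable_ignore_initial_segment)
      also have "\<dots> = (\<Sum>k. s ^ (k + Suc m) / fact (k + Suc m)) * norm x"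
        using exps by (intro suminf_mult2[symmetric] summable_ignore_initial_segment)
      also have "\<dots> \<le> 1 * norm x" using m0[of "Suc m"] m by (intro mult_right_mono) auto
      finally show ?thesis by simp
    qed
    have "(\<Sum>l\<le>m. trig_char (int l) t *\<^sub>C poisson_weight \<mu> l *\<^sub>R (T ^^ l) x) = exp (-\<mu>) *\<^sub>R (\<Sum>l\<le>m. f l)"
      unfolding f_def z_def poisson_weight_def scaleR_sum_right
      by (intro sum.cong) (auto simp: scaleR_scaleC scaleC_scaleC trig_char_power power_mult_distrib mult_ac)
    also have "(\<Sum>l\<le>m. f l) = (\<Sum>l. f l) - (\<Sum>k. f (k + Suc m))"
      using suminf_split_initial_segment[OF smf, of "Suc m"] by (simp add: lessThan_Suc_atMost)
    also have "norm (exp (-\<mu>) *\<^sub>R \<dots>) \<le> exp (-\<mu>) * (K * exp \<mu> * norm x + norm x)"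
    proof -
      have "norm (\<Sum>l. f l) \<le> K * exp \<mu> * norm x"
        using strongly_Kreiss_bounded_exp_series[OF T K z0, of x] by (simp add: f_def z)
      then have "norm ((\<Sum>l. f l) - (\<Sum>k. f (k + Suc m))) \<le> K * exp \<mu> * norm x + norm x"
        using tail norm_triangle_ineq4 by (meson add_mono order_trans)
      then show ?thesis by simp
    qed
    also have "\<dots> = (K + exp (-\<mu>)) * norm x"
      by (simp add: algebra_simps flip: exp_add)
    also have "\<dots> \<le> (\<bar>K\<bar> + 2) * norm x"
    proof (intro mult_right_mono add_mono)
      have "exp (-\<mu>) \<le> 1" using \<mu> by simp
      then show "exp (-\<mu>) \<le> 2" by linarith
    qed auto
    finally show "norm (\<Sum>l\<le>m. trig_char (int l) t *\<^sub>C poisson_weight \<mu> l *\<^sub>R (T ^^ l) x)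
        \<le> (\<bar>K\<bar> + 2) * norm x" .
  qed
qed

section \<open>Concentration of Poisson weights\<close>

lemma poisson_weight_sums: "poisson_weight \<mu> sums 1"
proof -
  have "(\<lambda>l. exp (-\<mu>) * (\<mu> ^ l / fact l)) sums (exp (-\<mu>) * exp \<mu>)"
    using exp_converges[of \<mu>] by (intro sums_mult) (simp add: field_simps)
  moreover have "poisson_weight \<mu> = (\<lambda>l. exp (-\<mu>) * (\<mu> ^ l / fact l))"
    by (simp add: poisson_weight_def fun_eq_iff)
  moreover have "exp (-\<mu>) * exp \<mu> = 1" by (simp add: exp_minus)
  ultimately show ?thesis by simp
qed

lemma poisson_weight_Suc: "real (Suc l) * poisson_weight \<mu> (Suc l) = \<mu> * poisson_weight \<mu> l"
proof -
  have "poisson_weight \<mu> (Suc l) = exp (-\<mu>) * (\<mu> * \<mu> ^ l) / (real (Suc l) * fact l)"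
    by (simp add: poisson_weight_def)
  then show ?thesis by (simp add: poisson_weight_def)
qed

text \<open>The recurrence for the weights gives the factorial moments \<mu> and \<mu>^2; then (l -
  \<mu>)^2 is expanded as l(l-1) + (1 - 2\<mu>) l + \<mu>^2.\<close>

lemma poisson_variance_sums: "(\<lambda>l. (real l - \<mu>)\<^sup>2 * poisson_weight \<mu> l) sums \<mu>"
proof -
  let ?w = "poisson_weight \<mu>"
  have 1: "(\<lambda>l. real l * ?w l) sums \<mu>"
    using sums_mult[OF poisson_weight_sums, of \<mu> \<mu>]
      sums_Suc[of "\<lambda>l. real l * ?w l" \<mu>] by (simp add: poisson_weight_Suc del: of_nat_Suc)
  have eq: "real (Suc l) * (real (Suc l) - 1) * ?w (Suc l) = \<mu> * (real l * ?w l)" for l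
    using arg_cong[OF poisson_weight_Suc[of l \<mu>], of "\<lambda>v. real l * v"] by (simp add: mult_ac)
  have "(\<lambda>l. real (Suc l) * (real (Suc l) - 1) * ?w (Suc l)) sums (\<mu> * \<mu>)"
    unfolding eq by (intro sums_mult 1)
  from sums_Suc[OF this]
  have 2: "(\<lambda>l. real l * (real l - 1) * ?w l) sums (\<mu> * \<mu>)" by simp
  have "(\<lambda>l. real l * (real l - 1) * ?w l + (1 - 2 * \<mu>) * (real l * ?w l) + \<mu>\<^sup>2 * ?w l)
      sums (\<mu> * \<mu> + (1 - 2 * \<mu>) * \<mu> + \<mu>\<^sup>2 * 1)"
    by (intro sums_add sums_mult 1 2 poisson_weight_sums)
  then show ?thesis by (simp add: algebra_simps power2_eq_square)
qed

text \<open>The value at m of the convolution of the Poisson weights with the indicator of {1..M}: l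
  = m - s with s in {1..M}. For m < M truncated subtraction starts the range at 0, as it
  should.\<close>

definition poisson_window :: "real \<Rightarrow> nat \<Rightarrow> nat \<Rightarrow> real" where
  "poisson_window \<mu> M m = (\<Sum>l=m-M..<m. poisson_weight \<mu> l)"

text \<open>Chebyshev's inequality; \<open>\<mu>\<close> is chosen two standard deviations below the window.\<close>

lemma poisson_window_ge:
  assumes j: "1 \<le> j" and m: "j\<^sup>2 \<le> m" "m \<le> j\<^sup>2 + 6 * j" and M: "10 * j \<le> M"
  shows "3 / 4 \<le> poisson_window ((real j - 1)\<^sup>2) M m"
proof -
  define \<mu> where "\<mu> = (real j - 1)\<^sup>2"
  define d where "d = 2 * real j - 1"
  have d: "d > 0" using j by (simp add: d_def)
  let ?w = "poisson_weight \<mu>"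
  have "(\<lambda>l. if l \<in> {m-M..<m} then ?w l else 0) sums (\<Sum>l=m-M..<m. ?w l)"
    by (rule sums_If_finite_set) simp
  then have s1: "(\<lambda>l. ?w l - (if l \<in> {m-M..<m} then ?w l else 0)) sums (1 - poisson_window \<mu> M m)"
    unfolding poisson_window_def by (intro sums_diff poisson_weight_sums)
  have s2: "(\<lambda>l. (real l - \<mu>)\<^sup>2 * ?w l / d\<^sup>2) sums (\<mu> / d\<^sup>2)"
    by (intro sums_divide poisson_variance_sums)
  have s3: "?w l - (if l \<in> {m-M..<m} then ?w l else 0) \<le> (real l - \<mu>)\<^sup>2 * ?w l / d\<^sup>2" for l
  proof (cases "l \<in> {m-M..<m}")
    case True
    then show ?thesis by (simp add: \<mu>_def)
  next
    case False
    \<comment> \<open>To the right of the window, l - \<mu> \<ge> j^2 - (j-1)^2 = 2j - 1 = d. To the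
      left, the length 10j exceeds the possible offset 6j of m by 4j, so \<mu> - l \<ge> 2j +
      1.\<close>
    have "d \<le> \<bar>real l - \<mu>\<bar>"
    proof (cases "m \<le> l")
      case True
      with m have "real (j\<^sup>2) \<le> real l" by linarith
      then show ?thesis by (simp add: \<mu>_def d_def power2_eq_square algebra_simps)
    next
      case F: False
      with False M m have "l + 4 * j \<le> j\<^sup>2" by auto
      then have "real (l + 4 * j) \<le> real (j\<^sup>2)" by (simp only: of_nat_le_iff)
      then have "real l + 4 * real j \<le> real j ^ 2" by simp
      then show ?thesis by (simp add: \<mu>_def d_def power2_eq_square algebra_simps)
    qed
    then have "d\<^sup>2 \<le> (real l - \<mu>)\<^sup>2" using d by (simp flip: abs_le_square_iff)
    then have "d\<^sup>2 * ?w l \<le> (real l - \<mu>)\<^sup>2 * ?w l"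
      by (intro mult_right_mono) (simp_all add: \<mu>_def)
    then have "?w l \<le> (real l - \<mu>)\<^sup>2 * ?w l / d\<^sup>2"
      using d by (simp add: pos_le_divide_eq mult.commute)
    then show ?thesis using False by (simp only: if_False diff_zero)
  qed
  have "1 - poisson_window \<mu> M m \<le> \<mu> / d\<^sup>2"
    by (rule sums_le[OF s3 s1 s2])
  also have "\<dots> \<le> 1 / 4"
  proof -
    have "4 * \<mu> \<le> d\<^sup>2" using j by (simp add: \<mu>_def d_def power2_eq_square algebra_simps)
    then show ?thesis using d by (simp add: divide_le_eq)
  qed
  finally show ?thesis by (simp add: \<mu>_def)
qed

text \<open>With F the distribution function, the window is F(m) - F(m - M), a difference of two
  increasing functions with values in [0,1], each of variation at most 1.\<close>

lemma poisson_window_variation: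
  assumes \<mu>: "\<mu> \<ge> 0" and "lo \<le> hi"
  shows "(\<Sum>l=lo..<hi. \<bar>poisson_window \<mu> M (Suc l) - poisson_window \<mu> M l\<bar>) \<le> 2"
proof -
  define F where "F m = (\<Sum>l<m. poisson_weight \<mu> l)" for m
  have mono: "F m \<le> F n" if "m \<le> n" for m n
    unfolding F_def using \<mu> that by (intro sum_mono2) auto
  have F: "0 \<le> F m" "F m \<le> 1" for m
    using \<mu> sum_le_suminf[OF sums_summable[OF poisson_weight_sums[of \<mu>]], of "{..<m}"]
      sums_unique[OF poisson_weight_sums[of \<mu>]] by (auto simp: F_def intro: sum_nonneg)
  have w: "poisson_window \<mu> M m = F m - F (m - M)" for m
    unfolding poisson_window_def F_def
    by (simp add: sum_diff[symmetric] lessThan_minus_lessThan)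
  have "(\<Sum>l=lo..<hi. \<bar>poisson_window \<mu> M (Suc l) - poisson_window \<mu> M l\<bar>)
      \<le> (\<Sum>l=lo..<hi. (F (Suc l) - F l) + (F (Suc l - M) - F (l - M)))"
  proof (rule sum_mono)
    fix l
    show "\<bar>poisson_window \<mu> M (Suc l) - poisson_window \<mu> M l\<bar>
        \<le> (F (Suc l) - F l) + (F (Suc l - M) - F (l - M))"
      using mono[of l "Suc l"] mono[OF diff_le_mono[of l "Suc l" M]] unfolding w by linarith
  qed
  also have "\<dots> = (F hi - F lo) + (F (hi - M) - F (lo - M))"
    using sum_Suc_diff'[OF assms(2), of F] sum_Suc_diff'[OF assms(2), of "\<lambda>l. F (l - M)"]
    by (simp only: sum.distrib)
  also have "\<dots> \<le> 2" using F[of hi] F[of lo] F[of "hi - M"] F[of "lo - M"] by linarith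
  finally show ?thesis .
qed

section \<open>Fourier multipliers of bounded variation\<close>

text \<open>The one consequence of the lower decomposition that the transference between windows
  relies on, with a single constant for all bounded intervals.\<close>

definition bounded_freq_proj :: "'a::complex_banach itself \<Rightarrow> real \<Rightarrow> real \<Rightarrow> bool" where
  "bounded_freq_proj _ p L \<longleftrightarrow> L > 0 \<and>
     (\<forall>a b. \<forall>f\<in>(trig_polys :: (real \<Rightarrow> 'a) set). Lp_norm p (freq_proj {a..b} f) \<le> L * Lp_norm p f)"

lemma bounded_freq_projD:
  fixes y :: "'i \<Rightarrow> 'a::complex_banach"
  assumes "bounded_freq_proj TYPE('a) p L" "finite S"
  shows "Lp_norm p (trig_sum {s\<in>S. \<nu> s \<in> {a..b}} \<nu> y) \<le> L * Lp_norm p (trig_sum S \<nu> y)"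
  using assms(1) trig_sum_in_trig_polys[OF assms(2), of \<nu> y]
  unfolding bounded_freq_proj_def freq_proj_trig_sum[OF assms(2), symmetric] by blast

lemma summation_by_parts:
  fixes v :: "nat \<Rightarrow> 'a::real_vector"
  assumes "lo \<le> hi"
  shows "(\<Sum>k=lo..hi. a k *\<^sub>R v k) =
    a hi *\<^sub>R (\<Sum>k=lo..hi. v k) + (\<Sum>l=lo..<hi. (a l - a (Suc l)) *\<^sub>R (\<Sum>k=lo..l. v k))"
  using assms
proof (induction hi rule: dec_induct)
  case (step hi)
  have "(\<Sum>k=lo..Suc hi. w k) = (\<Sum>k=lo..hi. w k) + w (Suc hi)" for w :: "nat \<Rightarrow> 'a"
    using step.hyps by (intro sum.cl_ivl_Suc[THEN trans]) auto
  moreover have "(\<Sum>l=lo..<Suc hi. w l) = (\<Sum>l=lo..<hi. w l) + w hi" for w :: "nat \<Rightarrow> 'a"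
    using step.hyps by simp
  ultimately show ?case
    using step.IH by (simp only: scaleR_add_right scaleR_left_diff_distrib) simp
qed simp

lemma trig_sum_scaleR:
  "trig_sum S \<nu> (\<lambda>s. a s *\<^sub>R y s) t = (\<Sum>s\<in>S. a s *\<^sub>R (trig_char (\<nu> s) t *\<^sub>C y s))"
  unfolding trig_sum_def by (simp add: scaleC.scaleR_right)

text \<open>Abel summation writes the weighted polynomial through its partial sums. Each partial sum
  is a projection of the full polynomial onto an interval of frequencies, hence bounded by L; this
  holds for both orientations of the frequencies.\<close>

lemma bounded_variation_multiplier:
  fixes y :: "nat \<Rightarrow> 'a::complex_banach"
  assumes P: "bounded_freq_proj TYPE('a) p L" and p: "p \<ge> 1" and "lo \<le> hi"
    and \<nu>: "\<nu> = int \<or> \<nu> = (\<lambda>k. - int k)"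
  shows "Lp_norm p (trig_sum {lo..hi} \<nu> (\<lambda>k. a k *\<^sub>R y k)) \<le>
    (\<bar>a hi\<bar> + L * (\<Sum>l=lo..<hi. \<bar>a (Suc l) - a l\<bar>)) * Lp_norm p (trig_sum {lo..hi} \<nu> y)"
proof -
  let ?f = "\<lambda>l. trig_sum {lo..l} \<nu> y"
  have cf: "continuous_on UNIV (\<lambda>t. r *\<^sub>R ?f l t)" for r l
    by (intro continuous_on_scaleR continuous_on_const continuous_on_trig_sum)
  have sc: "Lp_norm p (\<lambda>t. r *\<^sub>R ?f l t) \<le> \<bar>r\<bar> * Lp_norm p (?f l)" for r l
    using Lp_norm_scaleC[of p "?f l" "of_real r"] p
    unfolding scaleR_scaleC by (simp add: continuous_on_trig_sum)
  have pr: "Lp_norm p (?f l) \<le> L * Lp_norm p (?f hi)" if "l < hi" for l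
  proof -
    have "\<exists>u v. {lo..l} = {s\<in>{lo..hi}. \<nu> s \<in> {u..v}}"
      using \<nu>
    proof
      assume "\<nu> = int"
      then show ?thesis using that by (intro exI[of _ "int lo"] exI[of _ "int l"]) auto
    next
      assume "\<nu> = (\<lambda>k. - int k)"
      then show ?thesis using that by (intro exI[of _ "- int l"] exI[of _ "- int lo"]) auto
    qed
    then obtain u v where uv: "{lo..l} = {s\<in>{lo..hi}. \<nu> s \<in> {u..v}}" by blast
    show ?thesis unfolding uv by (rule bounded_freq_projD[OF P]) simp
  qed
  have eq: "trig_sum {lo..hi} \<nu> (\<lambda>k. a k *\<^sub>R y k) =
      (\<lambda>t. a hi *\<^sub>R ?f hi t + (\<Sum>l=lo..<hi. (a l - a (Suc l)) *\<^sub>R ?f l t))"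
  proof
    fix t
    show "trig_sum {lo..hi} \<nu> (\<lambda>k. a k *\<^sub>R y k) t =
        a hi *\<^sub>R ?f hi t + (\<Sum>l=lo..<hi. (a l - a (Suc l)) *\<^sub>R ?f l t)"
      unfolding trig_sum_scaleR trig_sum_def by (rule summation_by_parts[OF assms(3)])
  qed
  have "Lp_norm p (trig_sum {lo..hi} \<nu> (\<lambda>k. a k *\<^sub>R y k)) \<le> Lp_norm p (\<lambda>t. a hi *\<^sub>R ?f hi t)
      + Lp_norm p (\<lambda>t. \<Sum>l=lo..<hi. (a l - a (Suc l)) *\<^sub>R ?f l t)"
    unfolding eq by (intro Lp_norm_triangle[OF p] continuous_on_sum cf)
  also have "\<dots> \<le> \<bar>a hi\<bar> * Lp_norm p (?f hi) + (\<Sum>l=lo..<hi. \<bar>a (Suc l) - a l\<bar> * (L * Lp_norm p (?f hi)))"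
  proof (rule add_mono[OF sc])
    have "Lp_norm p (\<lambda>t. \<Sum>l=lo..<hi. (a l - a (Suc l)) *\<^sub>R ?f l t)
        \<le> (\<Sum>l=lo..<hi. Lp_norm p (\<lambda>t. (a l - a (Suc l)) *\<^sub>R ?f l t))"
      by (intro Lp_norm_sum[OF p] cf) simp
    also have "\<dots> \<le> (\<Sum>l=lo..<hi. \<bar>a (Suc l) - a l\<bar> * (L * Lp_norm p (?f hi)))"
    proof (rule sum_mono)
      fix l assume "l \<in> {lo..<hi}"
      then have "\<bar>a l - a (Suc l)\<bar> * Lp_norm p (?f l) \<le> \<bar>a l - a (Suc l)\<bar> * (L * Lp_norm p (?f hi))"
        by (intro mult_left_mono pr) auto
      from order_trans[OF sc this]
      show "Lp_norm p (\<lambda>t. (a l - a (Suc l)) *\<^sub>R ?f l t) \<le> \<bar>a (Suc l) - a l\<bar> * (L * Lp_norm p (?f hi))"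
        unfolding abs_minus_commute[of "a l"] .
    qed
    finally show "Lp_norm p (\<lambda>t. \<Sum>l=lo..<hi. (a l - a (Suc l)) *\<^sub>R ?f l t)
        \<le> (\<Sum>l=lo..<hi. \<bar>a (Suc l) - a l\<bar> * (L * Lp_norm p (?f hi)))" .
  qed
  also have "\<dots> = (\<bar>a hi\<bar> + L * (\<Sum>l=lo..<hi. \<bar>a (Suc l) - a l\<bar>)) * Lp_norm p (?f hi)"
    unfolding sum_distrib_right[symmetric] by (simp only: distrib_right mult.assoc mult.left_commute)
  finally show ?thesis .
qed

text \<open>Dividing out the Poisson weights. Since c \<ge> 3/4 on the window, products of
  neighbouring values exceed 1/2, so 1/c has at most twice the variation of c, that is at most 4,
  and its end value is at most 2.\<close>

lemma inverse_poisson_window_multiplier: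
  fixes y :: "nat \<Rightarrow> 'a::complex_banach"
  assumes P: "bounded_freq_proj TYPE('a) p L" and p: "p \<ge> 1"
    and \<nu>: "\<nu> = int \<or> \<nu> = (\<lambda>k. - int k)"
    and j: "1 \<le> j" and lo: "j\<^sup>2 \<le> lo" and hi: "hi \<le> j\<^sup>2 + 6 * j" and M: "10 * j \<le> M"
  defines "c \<equiv> poisson_window ((real j - 1)\<^sup>2) M"
  shows "Lp_norm p (trig_sum {lo..hi} \<nu> (\<lambda>k. (1 / c k) *\<^sub>R y k)) \<le>
    (2 + 4 * L) * Lp_norm p (trig_sum {lo..hi} \<nu> y)"
\<comment> \<open>Blocks cut off at N may be empty.\<close>
proof (cases "lo \<le> hi")
  case False
  then have "trig_sum {lo..hi} \<nu> z = (\<lambda>t. 0)" for z :: "nat \<Rightarrow> 'a" by (auto simp: trig_sum_def)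
  then show ?thesis using p by (simp add: Lp_norm_const_norm)
next
  case True
  have c: "3 / 4 \<le> c k" if "k \<in> {lo..hi}" for k
    unfolding c_def using that lo hi by (intro poisson_window_ge j M) auto
  have L: "L > 0" using P by (simp add: bounded_freq_proj_def)
  have "(\<Sum>l=lo..<hi. \<bar>1 / c (Suc l) - 1 / c l\<bar>) \<le> (\<Sum>l=lo..<hi. \<bar>c (Suc l) - c l\<bar> * 2)"
  proof (rule sum_mono)
    fix l assume "l \<in> {lo..<hi}"
    then have c': "3 / 4 \<le> c l" "3 / 4 \<le> c (Suc l)" using c[of l] c[of "Suc l"] by auto
    then have "(3/4) * (3/4) \<le> c l * c (Suc l)" by (intro mult_mono) auto
    then have cc: "1 / 2 \<le> c l * c (Suc l)" by simp
    have "1 / c (Suc l) - 1 / c l = (c l - c (Suc l)) * (1 / (c l * c (Suc l)))"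
      using c' by (simp add: field_simps)
    then have "\<bar>1 / c (Suc l) - 1 / c l\<bar> = \<bar>c (Suc l) - c l\<bar> * (1 / (c l * c (Suc l)))"
      using c' by (simp add: abs_mult)
    also have "\<dots> \<le> \<bar>c (Suc l) - c l\<bar> * 2"
      using cc c' by (intro mult_left_mono) (auto simp: divide_simps)
    finally show "\<bar>1 / c (Suc l) - 1 / c l\<bar> \<le> \<bar>c (Suc l) - c l\<bar> * 2" .
  qed
  also have "\<dots> \<le> 2 * 2"
    unfolding sum_distrib_right[symmetric] c_def using True
    by (intro mult_right_mono poisson_window_variation) auto
  finally have v: "(\<Sum>l=lo..<hi. \<bar>1 / c (Suc l) - 1 / c l\<bar>) \<le> 4" by simp
  have h: "\<bar>1 / c hi\<bar> \<le> 2" using c[of hi] True by (simp add: divide_simps)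
  have "Lp_norm p (trig_sum {lo..hi} \<nu> (\<lambda>k. (1 / c k) *\<^sub>R y k)) \<le>
    (\<bar>1 / c hi\<bar> + L * (\<Sum>l=lo..<hi. \<bar>1 / c (Suc l) - 1 / c l\<bar>)) * Lp_norm p (trig_sum {lo..hi} \<nu> y)"
    by (rule bounded_variation_multiplier[OF P p True \<nu>])
  also have "\<dots> \<le> (2 + L * 4) * Lp_norm p (trig_sum {lo..hi} \<nu> y)"
    using v h L by (intro mult_right_mono add_mono mult_left_mono) auto
  finally show ?thesis by (simp add: mult.commute)
qed

section \<open>Orbit estimates on Poisson windows\<close>

locale Kreiss_operator =
  fixes T :: "'a::complex_banach \<Rightarrow> 'a" and K p L :: real
  assumes T: "bounded_clinear T" and K: "strongly_Kreiss_bounded_with K T"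
    and p: "p \<ge> 1" and P: "bounded_freq_proj TYPE('a) p L"
begin

lemma L_pos: "L > 0"
  using P by (simp add: bounded_freq_proj_def)

lemma bounded_linear_power: "bounded_linear (T ^^ n)"
  using bounded_clinear_funpow[OF T] by (simp add: bounded_clinear_def)

lemma linear_power: "linear (T ^^ n)"
  using bounded_linear_power by (rule bounded_linear.linear)

lemma power_scaleC: "(T ^^ n) (a *\<^sub>C x) = a *\<^sub>C (T ^^ n) x"
  using bounded_clinear_funpow[OF T] by (simp add: bounded_clinear_def)

text \<open>At each t the double sum is the Poisson multiplier applied to the vector
  \<open>trig_sum S \<nu> y t\<close>, so the pointwise multiplier bound passes to the L^p norm. The
  projection to [a,b] then costs a factor L.\<close>

lemma poisson_convolution_bound:
  fixes y :: "'i \<Rightarrow> 'a"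
  assumes S: "finite S" and \<mu>: "\<mu> \<ge> 0"
  shows "\<exists>m0. \<forall>m\<ge>m0. \<forall>a b.
    Lp_norm p (trig_sum {(l, s). l \<le> m \<and> s \<in> S \<and> a \<le> int l + \<nu> s \<and> int l + \<nu> s \<le> b}
      (\<lambda>(l, s). int l + \<nu> s) (\<lambda>(l, s). poisson_weight \<mu> l *\<^sub>R (T ^^ l) (y s)))
    \<le> L * (\<bar>K\<bar> + 2) * Lp_norm p (trig_sum S \<nu> y)"
proof -
  obtain m0 where m0: "\<And>m t x. m \<ge> m0 \<Longrightarrow>
      norm (\<Sum>l\<le>m. trig_char (int l) t *\<^sub>C poisson_weight \<mu> l *\<^sub>R (T ^^ l) x) \<le> (\<bar>K\<bar> + 2) * norm x"
    using poisson_multiplier_bound[OF T K \<mu>] by blast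
  show ?thesis
  proof (intro exI[of _ m0] allI impI)
    fix m a b assume m: "m0 \<le> m"
    let ?\<eta> = "\<lambda>(l, s). int l + \<nu> s"
    let ?z = "\<lambda>(l, s). poisson_weight \<mu> l *\<^sub>R (T ^^ l) (y s)"
    let ?U = "trig_sum ({..m} \<times> S) ?\<eta> ?z"
    have eq: "?U t = (\<Sum>l\<le>m. trig_char (int l) t *\<^sub>C poisson_weight \<mu> l *\<^sub>R (T ^^ l) (trig_sum S \<nu> y t))" for t
    proof -
      have "?U t = (\<Sum>l\<le>m. \<Sum>s\<in>S. trig_char (int l + \<nu> s) t *\<^sub>C poisson_weight \<mu> l *\<^sub>R (T ^^ l) (y s))"
        unfolding trig_sum_def by (subst sum.cartesian_product) (auto intro!: sum.cong)
      also have "\<dots> = (\<Sum>l\<le>m. trig_char (int l) t *\<^sub>C poisson_weight \<mu> l *\<^sub>R (T ^^ l) (trig_sum S \<nu> y t))"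
      proof (rule sum.cong[OF refl])
        fix l
        have "(T ^^ l) (trig_sum S \<nu> y t) = (\<Sum>s\<in>S. trig_char (\<nu> s) t *\<^sub>C (T ^^ l) (y s))"
          unfolding trig_sum_def linear_sum[OF linear_power] power_scaleC ..
        then show "(\<Sum>s\<in>S. trig_char (int l + \<nu> s) t *\<^sub>C poisson_weight \<mu> l *\<^sub>R (T ^^ l) (y s))
            = trig_char (int l) t *\<^sub>C poisson_weight \<mu> l *\<^sub>R (T ^^ l) (trig_sum S \<nu> y t)"
          by (simp add: scaleR_sum_right scaleC.sum_right trig_char_add scaleC_scaleC[symmetric]
              scaleC.scaleR_right)
      qed
      finally show ?thesis .
    qed
    have set: "{(l, s). l \<le> m \<and> s \<in> S \<and> a \<le> int l + \<nu> s \<and> int l + \<nu> s \<le> b}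
        = {x \<in> {..m} \<times> S. ?\<eta> x \<in> {a..b}}" by auto
    have "Lp_norm p (trig_sum {x \<in> {..m} \<times> S. ?\<eta> x \<in> {a..b}} ?\<eta> ?z) \<le> L * Lp_norm p ?U"
      by (rule bounded_freq_projD[OF P]) (simp add: S)
    also have "\<dots> \<le> L * ((\<bar>K\<bar> + 2) * Lp_norm p (trig_sum S \<nu> y))"
    proof (intro mult_left_mono Lp_norm_mono continuous_on_trig_sum)
      show "norm (?U t) \<le> (\<bar>K\<bar> + 2) * norm (trig_sum S \<nu> y t)" for t
        unfolding eq by (rule m0[OF m])
    qed (use p L_pos in auto)
    finally show "Lp_norm p (trig_sum {(l, s). l \<le> m \<and> s \<in> S \<and> a \<le> int l + \<nu> s \<and> int l + \<nu> s \<le> b} ?\<eta> ?z)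
      \<le> L * (\<bar>K\<bar> + 2) * Lp_norm p (trig_sum S \<nu> y)"
      unfolding set by (simp add: mult.assoc)
  qed
qed

text \<open>Admissible constants are tracked in place of the least one, which avoids
  suprema.\<close>

definition forward_bound :: "nat \<Rightarrow> real \<Rightarrow> bool" where
  "forward_bound N a \<longleftrightarrow> (\<forall>x. Lp_norm p (trig_sum {1..N} int (\<lambda>k. (T ^^ k) x)) \<le> a * norm x)"

text \<open>The pre-adjoint of a \<open>forward_bound\<close> for the adjoint operator, which avoids the dual space.\<close>

definition backward_bound :: "nat \<Rightarrow> real \<Rightarrow> bool" where
  "backward_bound N b \<longleftrightarrow> (\<forall>y. norm (\<Sum>k=1..N. (T ^^ k) (y k))
     \<le> b * Lp_norm p (trig_sum {1..N} (\<lambda>k. - int k) y))"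

text \<open>The factor \<open>L * (\<bar>K\<bar> + 2)\<close> comes from convolving and projecting,
  \<open>2 + 4 * L\<close> from removing the Poisson weights.\<close>

definition window_const :: real where
  "window_const = (2 + 4 * L) * (L * (\<bar>K\<bar> + 2))"

lemma window_const_pos: "window_const > 0"
  unfolding window_const_def using L_pos by (intro mult_pos_pos) auto

lemma poisson_window_pos:
  assumes "1 \<le> j" "j\<^sup>2 \<le> lo" "hi \<le> j\<^sup>2 + 6 * j" "10 * j \<le> M" "k \<in> {lo..hi}"
  shows "poisson_window ((real j - 1)\<^sup>2) M k > 0"
  using poisson_window_ge[of j k M] assms by fastforce

lemma sum_poisson_fiber:
  assumes "k \<le> m"
  shows "(\<Sum>q\<in>{q. fst q \<le> m \<and> snd q \<in> {1..M} \<and> fst q + snd q = k}. poisson_weight \<mu> (fst q))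
    = poisson_window \<mu> M k"
  unfolding poisson_window_def using assms
  by (intro sum.reindex_bij_witness[of _ "\<lambda>l. (l, k - l)" fst]) auto

text \<open>Convolving the orbit over {1..M} with the Poisson weights produces T^l T^s x at
  frequency l + s. Collecting l + s = k gives T^k x with weight c_k, the Poisson window, and this
  weight is then divided out.\<close>

lemma forward_window:
  assumes A: "forward_bound M a"
    and j: "1 \<le> j" and lo: "j\<^sup>2 \<le> lo" and hi: "hi \<le> j\<^sup>2 + 6 * j" and M: "10 * j \<le> M"
  shows "Lp_norm p (trig_sum {lo..hi} int (\<lambda>k. (T ^^ k) x)) \<le> window_const * a * norm x"
proof -
  define \<mu> where "\<mu> = (real j - 1)\<^sup>2"
  define c where "c = poisson_window \<mu> M"
  have \<mu>: "\<mu> \<ge> 0" by (simp add: \<mu>_def)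
  obtain m0 where m0: "\<And>m a b. m0 \<le> m \<Longrightarrow>
      Lp_norm p (trig_sum {(l, s). l \<le> m \<and> s \<in> {1..M} \<and> a \<le> int l + int s \<and> int l + int s \<le> b}
      (\<lambda>(l, s). int l + int s) (\<lambda>(l, s). poisson_weight \<mu> l *\<^sub>R (T ^^ l) ((T ^^ s) x)))
    \<le> L * (\<bar>K\<bar> + 2) * Lp_norm p (trig_sum {1..M} int (\<lambda>k. (T ^^ k) x))"
    using poisson_convolution_bound[of "{1..M}" \<mu> int "\<lambda>k. (T ^^ k) x"] \<mu> by auto
  \<comment> \<open>With m \<ge> hi the truncation of the Poisson series cuts off no pair with l + s
    \<le> hi.\<close>
  define m where "m = max m0 hi"
  define D where "D = {(l, s). l \<le> m \<and> s \<in> {1..M} \<and> int lo \<le> int l + int s \<and> int l + int s \<le> int hi}"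
  have "finite D" by (rule finite_subset[of _ "{..m} \<times> {1..M}"]) (auto simp: D_def)
  then have "trig_sum D (\<lambda>(l, s). int l + int s) (\<lambda>(l, s). poisson_weight \<mu> l *\<^sub>R (T ^^ l) ((T ^^ s) x))
      = trig_sum {lo..hi} int
          (\<lambda>k. \<Sum>q\<in>{q\<in>D. (\<lambda>(l, s). l + s) q = k}. (\<lambda>(l, s). poisson_weight \<mu> l *\<^sub>R (T ^^ l) ((T ^^ s) x)) q)"
    by (intro trig_sum_group) (auto simp: D_def)
  also have "\<dots> = trig_sum {lo..hi} int (\<lambda>k. c k *\<^sub>R (T ^^ k) x)"
    unfolding trig_sum_def
  proof (intro ext sum.cong refl arg_cong2[where f = scaleC])
    fix k assume k: "k \<in> {lo..hi}"
    have "(\<Sum>q\<in>{q\<in>D. (\<lambda>(l, s). l + s) q = k}. (\<lambda>(l, s). poisson_weight \<mu> l *\<^sub>R (T ^^ l) ((T ^^ s) x)) q)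
      = (\<Sum>q\<in>{q. fst q \<le> m \<and> snd q \<in> {1..M} \<and> fst q + snd q = k}. poisson_weight \<mu> (fst q) *\<^sub>R (T ^^ k) x)"
      using k by (intro sum.cong) (auto simp: D_def funpow_add)
    also have "\<dots> = c k *\<^sub>R (T ^^ k) x"
      unfolding scaleR_sum_left[symmetric] c_def using k by (subst sum_poisson_fiber) (auto simp: m_def)
    finally show "(\<Sum>q\<in>{q\<in>D. (\<lambda>(l, s). l + s) q = k}. (\<lambda>(l, s). poisson_weight \<mu> l *\<^sub>R (T ^^ l) ((T ^^ s) x)) q)
      = c k *\<^sub>R (T ^^ k) x" .
  qed
  finally have eq: "trig_sum D (\<lambda>(l, s). int l + int s) (\<lambda>(l, s). poisson_weight \<mu> l *\<^sub>R (T ^^ l) ((T ^^ s) x))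
      = trig_sum {lo..hi} int (\<lambda>k. c k *\<^sub>R (T ^^ k) x)" .
  have eq2: "trig_sum {lo..hi} int (\<lambda>k. (T ^^ k) x) = trig_sum {lo..hi} int (\<lambda>k. (1 / c k) *\<^sub>R (c k *\<^sub>R (T ^^ k) x))"
    unfolding trig_sum_def
  proof (intro ext sum.cong refl arg_cong2[where f = scaleC])
    fix k assume "k \<in> {lo..hi}"
    then have "c k > 0" unfolding c_def \<mu>_def by (rule poisson_window_pos[OF j lo hi M])
    then show "(T ^^ k) x = (1 / c k) *\<^sub>R (c k *\<^sub>R (T ^^ k) x)" by simp
  qed
  have "Lp_norm p (trig_sum {lo..hi} int (\<lambda>k. (T ^^ k) x)) \<le>
      (2 + 4 * L) * Lp_norm p (trig_sum {lo..hi} int (\<lambda>k. c k *\<^sub>R (T ^^ k) x))"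
    unfolding eq2 unfolding c_def \<mu>_def
    by (rule inverse_poisson_window_multiplier[OF P p _ j lo hi M]) simp
  also have "\<dots> \<le> (2 + 4 * L) * (L * (\<bar>K\<bar> + 2) * Lp_norm p (trig_sum {1..M} int (\<lambda>k. (T ^^ k) x)))"
    unfolding eq[symmetric] D_def using L_pos by (intro mult_left_mono m0) (auto simp: m_def)
  also have "\<dots> \<le> (2 + 4 * L) * (L * (\<bar>K\<bar> + 2) * (a * norm x))"
    using A L_pos unfolding forward_bound_def by (intro mult_left_mono) auto
  finally show ?thesis by (simp add: window_const_def mult.assoc)
qed

text \<open>Dual to the forward case: the weights are divided out first. Convolving y_s / c_s at
  frequency -s with T^l and keeping the frequencies -r with r in {1..M} yields z_r, a weighted sum
  of T^l applied to y_s / c_s over s - l = r. Applying T^r and summing restores the sum of T^s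
  y_s.\<close>

lemma backward_window:
  assumes B: "backward_bound M b" and b: "b \<ge> 0"
    and j: "1 \<le> j" and lo: "j\<^sup>2 \<le> lo" and hi: "hi \<le> j\<^sup>2 + 6 * j" and M: "10 * j \<le> M"
  shows "norm (\<Sum>k=lo..hi. (T ^^ k) (y k))
    \<le> window_const * b * Lp_norm p (trig_sum {lo..hi} (\<lambda>k. - int k) y)"
proof -
  define \<mu> where "\<mu> = (real j - 1)\<^sup>2"
  define c where "c = poisson_window \<mu> M"
  have \<mu>: "\<mu> \<ge> 0" by (simp add: \<mu>_def)
  define y' where "y' k = (1 / c k) *\<^sub>R y k" for k
  let ?neg = "\<lambda>k. - int k"
  let ?g = "\<lambda>(l, s). poisson_weight \<mu> l *\<^sub>R (T ^^ l) (y' s)"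
  obtain m0 where m0: "\<And>m a b. m0 \<le> m \<Longrightarrow>
      Lp_norm p (trig_sum {(l, s). l \<le> m \<and> s \<in> {lo..hi} \<and> a \<le> int l + - int s \<and> int l + - int s \<le> b}
      (\<lambda>(l, s). int l + - int s) ?g)
    \<le> L * (\<bar>K\<bar> + 2) * Lp_norm p (trig_sum {lo..hi} ?neg y')"
    using poisson_convolution_bound[of "{lo..hi}" \<mu> ?neg y'] \<mu> by auto
  define m where "m = max m0 hi"
  define D where "D = {(l, s). l \<le> m \<and> s \<in> {lo..hi} \<and> - int M \<le> int l + - int s \<and> int l + - int s \<le> - 1}"
  have fD: "finite D" by (rule finite_subset[of _ "{..m} \<times> {lo..hi}"]) (auto simp: D_def)
  \<comment> \<open>Natural subtraction is exact on \<open>D\<close>, where l - s \<le> -1.\<close>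
  define d :: "nat \<times> nat \<Rightarrow> nat" where "d = (\<lambda>(l, s). s - l)"
  have dD: "d ` D \<subseteq> {1..M}" by (auto simp: D_def d_def)
  define z where "z r = (\<Sum>q\<in>{q\<in>D. d q = r}. ?g q)" for r
  have eq: "trig_sum D (\<lambda>(l, s). int l + - int s) ?g = trig_sum {1..M} ?neg z"
    unfolding z_def using fD dD by (intro trig_sum_group) (auto simp: D_def d_def)
  have "(\<Sum>r=1..M. (T ^^ r) (z r)) = (\<Sum>r=1..M. \<Sum>q\<in>{q\<in>D. d q = r}. poisson_weight \<mu> (fst q) *\<^sub>R (T ^^ snd q) (y' (snd q)))"
  proof (rule sum.cong[OF refl])
    fix r assume "r \<in> {1..M}"
    show "(T ^^ r) (z r) = (\<Sum>q\<in>{q\<in>D. d q = r}. poisson_weight \<mu> (fst q) *\<^sub>R (T ^^ snd q) (y' (snd q)))"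
      unfolding z_def linear_sum[OF linear_power]
    proof (rule sum.cong[OF refl])
      fix q assume "q \<in> {q\<in>D. d q = r}"
      then obtain l s where q: "q = (l, s)" "s = r + l" by (auto simp: D_def d_def)
      show "(T ^^ r) (?g q) = poisson_weight \<mu> (fst q) *\<^sub>R (T ^^ snd q) (y' (snd q))"
        by (simp add: q linear_scale[OF linear_power] funpow_add)
    qed
  qed
  also have "\<dots> = (\<Sum>q\<in>D. poisson_weight \<mu> (fst q) *\<^sub>R (T ^^ snd q) (y' (snd q)))"
    by (rule sum.group[OF fD _ dD]) simp
  also have "\<dots> = (\<Sum>k=lo..hi. \<Sum>q\<in>{q\<in>D. snd q = k}. poisson_weight \<mu> (fst q) *\<^sub>R (T ^^ snd q) (y' (snd q)))"
    by (rule sum.group[symmetric]) (use fD in \<open>auto simp: D_def\<close>)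
  also have "\<dots> = (\<Sum>k=lo..hi. (T ^^ k) (y k))"
  proof (rule sum.cong[OF refl])
    fix k assume k: "k \<in> {lo..hi}"
    have c: "c k > 0" unfolding c_def \<mu>_def by (rule poisson_window_pos[OF j lo hi M k])
    have "(\<Sum>q\<in>{q\<in>D. snd q = k}. poisson_weight \<mu> (fst q) *\<^sub>R (T ^^ snd q) (y' (snd q)))
        = (\<Sum>q\<in>{q\<in>D. snd q = k}. poisson_weight \<mu> (fst q)) *\<^sub>R (T ^^ k) (y' k)"
      unfolding scaleR_sum_left by (intro sum.cong) auto
    \<comment> \<open>For fixed s = k the constraint 1 \<le> k - l \<le> M leaves l in {k-M..<k},
      the same window as in the forward case.\<close>
    also have "(\<Sum>q\<in>{q\<in>D. snd q = k}. poisson_weight \<mu> (fst q)) = c k"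
      unfolding c_def poisson_window_def using k
      by (intro sum.reindex_bij_witness[of _ "\<lambda>l. (l, k)" fst]) (auto simp: D_def m_def)
    also have "c k *\<^sub>R (T ^^ k) (y' k) = (T ^^ k) (y k)"
      using c by (simp add: y'_def linear_scale[OF linear_power])
    finally show "(\<Sum>q\<in>{q\<in>D. snd q = k}. poisson_weight \<mu> (fst q) *\<^sub>R (T ^^ snd q) (y' (snd q))) = (T ^^ k) (y k)" .
  qed
  finally have "norm (\<Sum>k=lo..hi. (T ^^ k) (y k)) \<le> b * Lp_norm p (trig_sum {1..M} ?neg z)"
    using B unfolding backward_bound_def by metis
  also have "\<dots> \<le> b * (L * (\<bar>K\<bar> + 2) * Lp_norm p (trig_sum {lo..hi} ?neg y'))"
    unfolding eq[symmetric] D_def using b by (intro mult_left_mono m0) (auto simp: m_def)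
  also have "\<dots> \<le> b * (L * (\<bar>K\<bar> + 2) * ((2 + 4 * L) * Lp_norm p (trig_sum {lo..hi} ?neg y)))"
    unfolding y'_def c_def \<mu>_def using b L_pos
    by (intro mult_left_mono inverse_poisson_window_multiplier[OF P p _ j lo hi M]) auto
  finally show ?thesis by (simp only: window_const_def mult_ac)
qed

end

section \<open>Decompositions along the squares\<close>

text \<open>An interval outside the subfamily contains no frequency of the polynomial, so its
  projection vanishes; \<open>0 powr q = 0\<close> for every q.\<close>

lemma partition_infsum_trig_sum:
  fixes y :: "'i \<Rightarrow> 'a::complex_banach"
  assumes P: "interval_partition P" and S: "finite S" and I: "finite \<I>" "\<I> \<subseteq> P" "\<nu> ` S \<subseteq> \<Union>\<I>"
    and p: "p > 0"
  shows "(\<Sum>\<^sub>\<infinity>I\<in>P. Lp_norm p (freq_proj I (trig_sum S \<nu> y)) powr q)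
    = (\<Sum>I\<in>\<I>. Lp_norm p (trig_sum {s\<in>S. \<nu> s \<in> I} \<nu> y) powr q)"
proof -
  have "(\<Sum>\<^sub>\<infinity>I\<in>P. Lp_norm p (freq_proj I (trig_sum S \<nu> y)) powr q)
      = (\<Sum>\<^sub>\<infinity>I\<in>\<I>. Lp_norm p (freq_proj I (trig_sum S \<nu> y)) powr q)"
  proof (rule infsum_cong_neutral)
    fix A assume A: "A \<in> P - \<I>"
    have "disjoint P" using P unfolding interval_partition_def by (auto dest: partition_onD2)
    have "A \<inter> B = {}" if "B \<in> \<I>" for B
      using A I(2) that by (intro disjointD[OF \<open>disjoint P\<close>]) auto
    then have e: "{s\<in>S. \<nu> s \<in> A} = {}" using I(3) by blast
    show "Lp_norm p (freq_proj A (trig_sum S \<nu> y)) powr q = 0"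
      unfolding freq_proj_trig_sum[OF S] e using p by (simp add: trig_sum_def Lp_norm_const_norm)
  qed (use I in auto)
  then show ?thesis using I(1) by (simp add: freq_proj_trig_sum[OF S])
qed

lemma interval_partition_three:
  assumes "a \<le> (b::int)"
  shows "interval_partition {{..<a}, {a..b}, {b<..}}"
proof -
  have "partition_on UNIV {{..<a}, {a..b}, {b<..}}"
  proof (rule partition_onI)
    have "a - 1 \<in> {..<a}" "a \<in> {a..b}" "b + 1 \<in> {b<..}"
      using assms by auto
    then show "{} \<notin> {{..<a}, {a..b}, {b<..}}" by blast
  qed (use assms in \<open>auto simp: disjnt_def\<close>)
  then show ?thesis by (auto simp: interval_partition_def int_interval_def)
qed

text \<open>The interval [a,b] is one block of a three-block partition, and one term of an l^q sum
  is at most the whole.\<close>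

lemma lower_decompositions_imp_bounded_freq_proj:
  assumes "lower_decompositions TYPE('a::complex_banach) q p" and q: "q > 0" and p: "p > 0"
  shows "\<exists>L. bounded_freq_proj TYPE('a) p L"
proof -
  obtain L where L: "L > 0" "\<And>P f. interval_partition P \<Longrightarrow> f \<in> (trig_polys :: (real \<Rightarrow> 'a) set) \<Longrightarrow>
      (\<Sum>\<^sub>\<infinity>I\<in>P. Lp_norm p (freq_proj I f) powr q) powr (1 / q) \<le> L * Lp_norm p f"
    using assms unfolding lower_decompositions_def by blast
  have "Lp_norm p (freq_proj {a..b} f) \<le> L * Lp_norm p f"
    if f: "f \<in> (trig_polys :: (real \<Rightarrow> 'a) set)" for a b f
  proof (cases "a \<le> b")
    case False
    then show ?thesis using L(1) p by (simp add: freq_proj_def Lp_norm_const_norm)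
  next
    case True
    let ?P = "{{..<a}, {a..b}, {b<..}}"
    have "Lp_norm p (freq_proj {a..b} f) = (Lp_norm p (freq_proj {a..b} f) powr q) powr (1 / q)"
      using q by (simp add: powr_powr)
    also have "Lp_norm p (freq_proj {a..b} f) powr q \<le> (\<Sum>I\<in>?P. Lp_norm p (freq_proj I f) powr q)"
      by (rule member_le_sum) auto
    then have "(Lp_norm p (freq_proj {a..b} f) powr q) powr (1 / q)
        \<le> (\<Sum>I\<in>?P. Lp_norm p (freq_proj I f) powr q) powr (1 / q)"
      using q by (intro powr_mono2) auto
    also have "\<dots> = (\<Sum>\<^sub>\<infinity>I\<in>?P. Lp_norm p (freq_proj I f) powr q) powr (1 / q)"
      by (subst infsum_finite) auto
    also have "\<dots> \<le> L * Lp_norm p f"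
      by (rule L(2)[OF interval_partition_three[OF True] f])
    finally show ?thesis .
  qed
  then show ?thesis using L(1) unfolding bounded_freq_proj_def by blast
qed

lemma floor_sqrt_fiber:
  assumes "j \<ge> 1"
  shows "{k\<in>{1..N}. floor_sqrt k = j} = {j\<^sup>2..min N (j\<^sup>2 + 2 * j)}"
proof -
  have "floor_sqrt k = j \<longleftrightarrow> j\<^sup>2 \<le> k \<and> k \<le> j\<^sup>2 + 2 * j" for k
  proof -
    have s: "(Suc j)\<^sup>2 = j\<^sup>2 + 2 * j + 1" by (simp add: power2_eq_square)
    show ?thesis
    proof
      assume "floor_sqrt k = j"
      then show "j\<^sup>2 \<le> k \<and> k \<le> j\<^sup>2 + 2 * j"
        using floor_sqrt_power2_le[of k] Suc_floor_sqrt_power2_gt[of k] s by simp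
    next
      assume "j\<^sup>2 \<le> k \<and> k \<le> j\<^sup>2 + 2 * j"
      then show "floor_sqrt k = j" using s by (intro floor_sqrt_unique) auto
    qed
  qed
  moreover have "1 \<le> j\<^sup>2" using assms by simp
  ultimately show ?thesis by fastforce
qed

text \<open>The intervals \<open>[j\<^sup>2, (j + 1)\<^sup>2)\<close>, \<open>j \<ge> 1\<close>, and one half-line, or their reflections.\<close>

lemma squares_partition:
  fixes p :: real
  assumes \<nu>: "\<nu> = int \<or> \<nu> = (\<lambda>k. - int k)" and p: "p > 0"
  obtains P where "interval_partition P"
    and "\<And>N J q (y :: nat \<Rightarrow> 'a::complex_banach). N < (Suc J)\<^sup>2 \<Longrightarrow>
      (\<Sum>\<^sub>\<infinity>I\<in>P. Lp_norm p (freq_proj I (trig_sum {1..N} \<nu> y)) powr q)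
      = (\<Sum>j=1..J. Lp_norm p (trig_sum {j\<^sup>2..min N (j\<^sup>2 + 2 * j)} \<nu> y) powr q)"
proof -
  \<comment> \<open>The involution \<sigma> treats both orientations at once.\<close>
  obtain \<sigma> :: "int \<Rightarrow> int" where \<sigma>: "\<And>n. \<sigma> (\<sigma> n) = n" "\<And>k. \<nu> k = \<sigma> (int k)" "\<sigma> = (\<lambda>n. n) \<or> \<sigma> = uminus"
    using \<nu>
  proof
    assume "\<nu> = int" then show ?thesis using that[of "\<lambda>n. n"] by simp
  next
    assume "\<nu> = (\<lambda>k. - int k)" then show ?thesis using that[of uminus] by simp
  qed
  \<comment> \<open>\<open>nat\<close> sends negative integers to 0, so \<open>B 0\<close> consists
    of all n with \<sigma> n \<le> 0: it is the half-line of the partition.\<close>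
  define B where "B j = {n. floor_sqrt (nat (\<sigma> n)) = j}" for j
  have ne: "\<sigma> (int (j\<^sup>2)) \<in> B j" for j by (simp add: B_def \<sigma>(1) del: of_nat_power)
  have inj: "inj_on B A" for A
  proof (rule inj_onI)
    fix i j assume "B i = B j"
    then have "\<sigma> (int (i\<^sup>2)) \<in> B j" using ne[of i] by simp
    then show "i = j" using ne[of i] by (simp add: B_def)
  qed
  have P: "interval_partition (range B)"
    unfolding interval_partition_def
  proof
    show "partition_on UNIV (range B)"
    proof (rule partition_onI)
      show "{} \<notin> range B" using ne by blast
    qed (auto simp: B_def disjnt_def)
    have "n \<in> B j" if "a \<in> B j" "b \<in> B j" "n \<in> {a..b}" for a b n j
    proof -
      have "floor_sqrt (nat (\<sigma> n)) \<le> j" "j \<le> floor_sqrt (nat (\<sigma> n))"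
        using \<sigma>(3) that mono_floor_sqrt'[of "nat (\<sigma> a)" "nat (\<sigma> n)"] mono_floor_sqrt'[of "nat (\<sigma> b)" "nat (\<sigma> n)"]
          mono_floor_sqrt'[of "nat (\<sigma> n)" "nat (\<sigma> a)"] mono_floor_sqrt'[of "nat (\<sigma> n)" "nat (\<sigma> b)"]
        by (auto simp: B_def)
      then show ?thesis by (simp add: B_def)
    qed
    then show "\<forall>I\<in>range B. int_interval I" unfolding int_interval_def by blast
  qed
  have "(\<Sum>\<^sub>\<infinity>I\<in>range B. Lp_norm p (freq_proj I (trig_sum {1..N} \<nu> y)) powr q)
      = (\<Sum>j=1..J. Lp_norm p (trig_sum {j\<^sup>2..min N (j\<^sup>2 + 2 * j)} \<nu> y) powr q)"
    if N: "N < (Suc J)\<^sup>2" for N J q and y :: "nat \<Rightarrow> 'a"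
  proof -
    have "\<nu> ` {1..N} \<subseteq> \<Union>(B ` {1..J})"
    proof (rule image_subsetI)
      fix k assume k: "k \<in> {1..N}"
      have "(floor_sqrt k)\<^sup>2 < (Suc J)\<^sup>2"
        using N k floor_sqrt_power2_le[of k] unfolding atLeastAtMost_iff by linarith
      then have "floor_sqrt k < Suc J" by (rule power_less_imp_less_base) simp
      moreover have "1 \<le> floor_sqrt k" using k floor_sqrt_greater_zero_iff[of k] by (simp add: Suc_le_eq)
      moreover have "\<nu> k \<in> B (floor_sqrt k)" by (simp add: B_def \<sigma>)
      ultimately show "\<nu> k \<in> \<Union>(B ` {1..J})" by auto
    qed
    then have "(\<Sum>\<^sub>\<infinity>I\<in>range B. Lp_norm p (freq_proj I (trig_sum {1..N} \<nu> y)) powr q)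
        = (\<Sum>I\<in>B ` {1..J}. Lp_norm p (trig_sum {k\<in>{1..N}. \<nu> k \<in> I} \<nu> y) powr q)"
      by (intro partition_infsum_trig_sum P p) auto
    also have "\<dots> = (\<Sum>j=1..J. Lp_norm p (trig_sum {k\<in>{1..N}. \<nu> k \<in> B j} \<nu> y) powr q)"
      by (subst sum.reindex[OF inj]) simp
    also have "\<dots> = (\<Sum>j=1..J. Lp_norm p (trig_sum {j\<^sup>2..min N (j\<^sup>2 + 2 * j)} \<nu> y) powr q)"
    proof (rule sum.cong[OF refl])
      fix j assume "j \<in> {1..J}"
      then have "{k\<in>{1..N}. \<nu> k \<in> B j} = {j\<^sup>2..min N (j\<^sup>2 + 2 * j)}"
        using floor_sqrt_fiber[of j N] by (simp add: B_def \<sigma>)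
      then show "Lp_norm p (trig_sum {k\<in>{1..N}. \<nu> k \<in> B j} \<nu> y) powr q
        = Lp_norm p (trig_sum {j\<^sup>2..min N (j\<^sup>2 + 2 * j)} \<nu> y) powr q" by simp
    qed
    finally show ?thesis .
  qed
  with P show ?thesis by (rule that)
qed

lemma sum_over_squares:
  fixes f :: "nat \<Rightarrow> 'a::comm_monoid_add"
  assumes N: "N < (Suc J)\<^sup>2"
  shows "(\<Sum>k=1..N. f k) = (\<Sum>j=1..J. \<Sum>k=j\<^sup>2..min N (j\<^sup>2 + 2 * j). f k)"
proof -
  have "floor_sqrt ` {1..N} \<subseteq> {1..J}"
  proof (rule image_subsetI)
    fix k assume k: "k \<in> {1..N}"
    have "(floor_sqrt k)\<^sup>2 < (Suc J)\<^sup>2"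
      using N k floor_sqrt_power2_le[of k] unfolding atLeastAtMost_iff by linarith
    then have "floor_sqrt k < Suc J" by (rule power_less_imp_less_base) simp
    then show "floor_sqrt k \<in> {1..J}" using k floor_sqrt_greater_zero_iff[of k] by (simp add: Suc_le_eq)
  qed
  then have "(\<Sum>k=1..N. f k) = (\<Sum>j=1..J. \<Sum>k\<in>{k\<in>{1..N}. floor_sqrt k = j}. f k)"
    by (intro sum.group[symmetric]) auto
  also have "\<dots> = (\<Sum>j=1..J. \<Sum>k=j\<^sup>2..min N (j\<^sup>2 + 2 * j). f k)"
    by (intro sum.cong refl floor_sqrt_fiber) auto
  finally show ?thesis .
qed

text \<open>Jensen's inequality for x^q with equal weights.\<close>

lemma sum_le_powr_mean:
  fixes x :: "'i \<Rightarrow> real"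
  assumes q: "q \<ge> 1" and A: "finite A" and x: "\<And>i. i \<in> A \<Longrightarrow> x i \<ge> 0"
  shows "(\<Sum>i\<in>A. x i) \<le> real (card A) powr (1 - 1 / q) * (\<Sum>i\<in>A. x i powr q) powr (1 / q)"
proof (cases "A = {}")
  case False
  define n where "n = real (card A)"
  have n: "n > 0" using A False by (simp add: n_def card_gt_0_iff)
  have "(\<Sum>i\<in>A. (1 / n) *\<^sub>R x i) powr q \<le> (\<Sum>i\<in>A. (1 / n) * x i powr q)"
    using A False x n
    by (intro convex_on_sum[OF _ _ convex_on_powr_nonneg[OF q]]) (auto simp: n_def)
  then have "((\<Sum>i\<in>A. x i) / n) powr q \<le> (\<Sum>i\<in>A. x i powr q) / n"
    by (simp add: sum_divide_distrib)
  then have "(((\<Sum>i\<in>A. x i) / n) powr q) powr (1 / q) \<le> ((\<Sum>i\<in>A. x i powr q) / n) powr (1 / q)"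
    using q by (intro powr_mono2) auto
  moreover have "(\<Sum>i\<in>A. x i) \<ge> 0" using x by (intro sum_nonneg) auto
  ultimately have "(\<Sum>i\<in>A. x i) / n \<le> (\<Sum>i\<in>A. x i powr q) powr (1 / q) / n powr (1 / q)"
    using q n by (simp add: powr_powr powr_divide sum_nonneg)
  then have "(\<Sum>i\<in>A. x i) \<le> n * ((\<Sum>i\<in>A. x i powr q) powr (1 / q) / n powr (1 / q))"
    using n by (simp add: pos_divide_le_eq mult.commute)
  also have "\<dots> = n powr (1 - 1 / q) * (\<Sum>i\<in>A. x i powr q) powr (1 / q)"
    using n by (simp add: powr_diff)
  finally show ?thesis by (simp add: n_def)
qed simp

section \<open>The recursion\<close>

context Kreiss_operator
begin

lemma forward_bound_mono: "forward_bound N a \<Longrightarrow> a \<le> b \<Longrightarrow> forward_bound N b"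
  unfolding forward_bound_def by (meson mult_right_mono norm_ge_zero order_trans)

lemma backward_bound_mono: "backward_bound N a \<Longrightarrow> a \<le> b \<Longrightarrow> backward_bound N b"
  unfolding backward_bound_def by (meson mult_right_mono Lp_norm_nonneg order_trans)

lemma Lp_norm_char: "Lp_norm p (\<lambda>t. trig_char n t *\<^sub>C (x::'a)) = norm x"
  using p by (intro Lp_norm_const_norm) (auto simp: norm_scaleC)

text \<open>A crude constant that starts the recursion.\<close>

lemma forward_bound_exists: "\<exists>a\<ge>0. forward_bound N a"
proof (intro exI conjI)
  show "0 \<le> (\<Sum>k=1..N. onorm (T ^^ k))"
    by (intro sum_nonneg onorm_pos_le bounded_linear_power)
  show "forward_bound N (\<Sum>k=1..N. onorm (T ^^ k))"
    unfolding forward_bound_def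
  proof
    fix x
    have "Lp_norm p (trig_sum {1..N} int (\<lambda>k. (T ^^ k) x))
        \<le> (\<Sum>k=1..N. Lp_norm p (\<lambda>t. trig_char (int k) t *\<^sub>C (T ^^ k) x))"
      unfolding trig_sum_def[abs_def]
      by (intro Lp_norm_sum p scaleC.continuous_on continuous_on_trig_char continuous_on_const) auto
    also have "\<dots> \<le> (\<Sum>k=1..N. onorm (T ^^ k) * norm x)"
      unfolding Lp_norm_char by (intro sum_mono onorm bounded_linear_power)
    finally show "Lp_norm p (trig_sum {1..N} int (\<lambda>k. (T ^^ k) x)) \<le> (\<Sum>k=1..N. onorm (T ^^ k)) * norm x"
      by (simp add: sum_distrib_right)
  qed
qed

lemma backward_bound_exists: "\<exists>b\<ge>0. backward_bound N b"
proof (intro exI conjI)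
  show "0 \<le> (\<Sum>k=1..N. onorm (T ^^ k) * L)"
    using L_pos by (intro sum_nonneg mult_nonneg_nonneg onorm_pos_le bounded_linear_power) auto
  show "backward_bound N (\<Sum>k=1..N. onorm (T ^^ k) * L)"
    unfolding backward_bound_def
  proof
    fix y :: "nat \<Rightarrow> 'a"
    let ?f = "trig_sum {1..N} (\<lambda>k. - int k) y"
    \<comment> \<open>Projecting to the single frequency -k recovers the coefficient y_k.\<close>
    have y: "norm (y k) \<le> L * Lp_norm p ?f" if "k \<in> {1..N}" for k
    proof -
      have "{s\<in>{1..N}. - int s \<in> {- int k..- int k}} = {k}" using that by auto
      moreover have "trig_sum {k} (\<lambda>k. - int k) y = (\<lambda>t. trig_char (- int k) t *\<^sub>C y k)"
        by (simp add: trig_sum_def fun_eq_iff)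
      ultimately show ?thesis
        using bounded_freq_projD[OF P, of "{1..N}" "\<lambda>k. - int k" "- int k" "- int k" y]
        by (simp only: Lp_norm_char finite_atLeastAtMost)
    qed
    have "norm (\<Sum>k=1..N. (T ^^ k) (y k)) \<le> (\<Sum>k=1..N. norm ((T ^^ k) (y k)))"
      by (rule norm_sum)
    also have "\<dots> \<le> (\<Sum>k=1..N. onorm (T ^^ k) * (L * Lp_norm p ?f))"
    proof (rule sum_mono)
      fix k assume k: "k \<in> {1..N}"
      have "norm ((T ^^ k) (y k)) \<le> onorm (T ^^ k) * norm (y k)"
        by (rule onorm[OF bounded_linear_power])
      also have "\<dots> \<le> onorm (T ^^ k) * (L * Lp_norm p ?f)"
        by (intro mult_left_mono y k onorm_pos_le bounded_linear_power)
      finally show "norm ((T ^^ k) (y k)) \<le> onorm (T ^^ k) * (L * Lp_norm p ?f)" .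
    qed
    finally show "norm (\<Sum>k=1..N. (T ^^ k) (y k)) \<le> (\<Sum>k=1..N. onorm (T ^^ k) * L) * Lp_norm p ?f"
      by (simp add: sum_distrib_right mult.assoc)
  qed
qed

text \<open>Every block [j^2, j^2 + 2j] with j \<le> J is a window for M = 10J, so all blocks obey
  the same bound, and the l^q sum of J equal terms contributes J^(1/q). The constant depends on none
  of J, N and a.\<close>

lemma forward_bound_step:
  assumes upper: "upper_decompositions TYPE('a) q p" and q: "q > 1"
  obtains C where "C \<ge> 0" "\<And>J N a. J \<ge> 1 \<Longrightarrow> N < (Suc J)\<^sup>2 \<Longrightarrow> 0 \<le> a \<Longrightarrow> forward_bound (10 * J) a
    \<Longrightarrow> forward_bound N (C * real J powr (1 / q) * a)"
proof -
  obtain U where U: "U > 0" "\<And>P f. interval_partition P \<Longrightarrow> f \<in> (trig_polys :: (real \<Rightarrow> 'a) set) \<Longrightarrow>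
      Lp_norm p f \<le> U * (\<Sum>\<^sub>\<infinity>I\<in>P. Lp_norm p (freq_proj I f) powr q) powr (1 / q)"
    using upper unfolding upper_decompositions_def by blast
  have p0: "p > 0" using p by simp
  obtain P where P: "interval_partition P" "\<And>N J q (y :: nat \<Rightarrow> 'a). N < (Suc J)\<^sup>2 \<Longrightarrow>
      (\<Sum>\<^sub>\<infinity>I\<in>P. Lp_norm p (freq_proj I (trig_sum {1..N} int y)) powr q)
      = (\<Sum>j=1..J. Lp_norm p (trig_sum {j\<^sup>2..min N (j\<^sup>2 + 2 * j)} int y) powr q)"
    using squares_partition[of int p] p0 by blast
  show ?thesis
  proof (rule that[of "U * window_const"])
    show "0 \<le> U * window_const" using U(1) window_const_pos by simp
    fix J N a assume J: "J \<ge> 1" and N: "N < (Suc J)\<^sup>2" and a: "0 \<le> a" and A: "forward_bound (10 * J) a"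
    show "forward_bound N (U * window_const * real J powr (1 / q) * a)"
      unfolding forward_bound_def
    proof
      fix x :: 'a
      define d where "d = window_const * a * norm x"
      have d: "d \<ge> 0" using window_const_pos a by (simp add: d_def)
      let ?y = "\<lambda>k. (T ^^ k) x"
      have "(\<Sum>j=1..J. Lp_norm p (trig_sum {j\<^sup>2..min N (j\<^sup>2 + 2 * j)} int ?y) powr q) \<le> (\<Sum>j=1..J. d powr q)"
      proof (rule sum_mono)
        fix j assume "j \<in> {1..J}"
        then have "Lp_norm p (trig_sum {j\<^sup>2..min N (j\<^sup>2 + 2 * j)} int ?y) \<le> d"
          unfolding d_def by (intro forward_window[OF A, of j]) auto
        then show "Lp_norm p (trig_sum {j\<^sup>2..min N (j\<^sup>2 + 2 * j)} int ?y) powr q \<le> d powr q"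
          using q by (intro powr_mono2) auto
      qed
      then have "(\<Sum>j=1..J. Lp_norm p (trig_sum {j\<^sup>2..min N (j\<^sup>2 + 2 * j)} int ?y) powr q) powr (1 / q)
          \<le> (real J * d powr q) powr (1 / q)"
        using q by (intro powr_mono2) (auto intro!: sum_nonneg)
      also have "\<dots> = real J powr (1 / q) * d"
        using q d by (simp add: powr_mult powr_powr)
      finally have "U * (\<Sum>\<^sub>\<infinity>I\<in>P. Lp_norm p (freq_proj I (trig_sum {1..N} int ?y)) powr q) powr (1 / q)
          \<le> U * (real J powr (1 / q) * d)"
        unfolding P(2)[OF N] using U(1) by (intro mult_left_mono) auto
      moreover have "Lp_norm p (trig_sum {1..N} int ?y)
          \<le> U * (\<Sum>\<^sub>\<infinity>I\<in>P. Lp_norm p (freq_proj I (trig_sum {1..N} int ?y)) powr q) powr (1 / q)"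
        by (intro U(2) P(1) trig_sum_in_trig_polys) simp
      ultimately show "Lp_norm p (trig_sum {1..N} int ?y) \<le> U * window_const * real J powr (1 / q) * a * norm x"
        by (simp add: d_def mult_ac)
    qed
  qed
qed

text \<open>The triangle inequality over the blocks leaves an l^1 sum of window bounds. Passing to
  l^q costs J^(1 - 1/q), and the lower decomposition along the reflected squares reassembles the
  blocks.\<close>

lemma backward_bound_step:
  assumes lower: "lower_decompositions TYPE('a) q p" and q: "q > 1"
  obtains C where "C \<ge> 0" "\<And>J N b. J \<ge> 1 \<Longrightarrow> N < (Suc J)\<^sup>2 \<Longrightarrow> 0 \<le> b \<Longrightarrow> backward_bound (10 * J) b
    \<Longrightarrow> backward_bound N (C * real J powr (1 - 1 / q) * b)"
proof -
  obtain L' where L': "L' > 0" "\<And>P f. interval_partition P \<Longrightarrow> f \<in> (trig_polys :: (real \<Rightarrow> 'a) set) \<Longrightarrow>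
      (\<Sum>\<^sub>\<infinity>I\<in>P. Lp_norm p (freq_proj I f) powr q) powr (1 / q) \<le> L' * Lp_norm p f"
    using lower unfolding lower_decompositions_def by blast
  have p0: "p > 0" using p by simp
  let ?neg = "\<lambda>k. - int k"
  obtain P where P: "interval_partition P" "\<And>N J q (y :: nat \<Rightarrow> 'a). N < (Suc J)\<^sup>2 \<Longrightarrow>
      (\<Sum>\<^sub>\<infinity>I\<in>P. Lp_norm p (freq_proj I (trig_sum {1..N} ?neg y)) powr q)
      = (\<Sum>j=1..J. Lp_norm p (trig_sum {j\<^sup>2..min N (j\<^sup>2 + 2 * j)} ?neg y) powr q)"
    using squares_partition[of ?neg p] p0 by blast
  show ?thesis
  proof (rule that[of "window_const * L'"])
    show "0 \<le> window_const * L'" using L'(1) window_const_pos by simp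
    fix J N b assume J: "J \<ge> 1" and N: "N < (Suc J)\<^sup>2" and b: "0 \<le> b" and B: "backward_bound (10 * J) b"
    show "backward_bound N (window_const * L' * real J powr (1 - 1 / q) * b)"
      unfolding backward_bound_def
    proof
      fix y :: "nat \<Rightarrow> 'a"
      let ?x = "\<lambda>j. Lp_norm p (trig_sum {j\<^sup>2..min N (j\<^sup>2 + 2 * j)} ?neg y)"
      have "norm (\<Sum>k=1..N. (T ^^ k) (y k)) \<le> (\<Sum>j=1..J. norm (\<Sum>k=j\<^sup>2..min N (j\<^sup>2 + 2 * j). (T ^^ k) (y k)))"
        unfolding sum_over_squares[OF N] by (rule norm_sum)
      also have "\<dots> \<le> (\<Sum>j=1..J. window_const * b * ?x j)"
        by (intro sum_mono backward_window[OF B b]) auto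
      also have "\<dots> = window_const * b * (\<Sum>j=1..J. ?x j)"
        by (rule sum_distrib_left[symmetric])
      also have "\<dots> \<le> window_const * b * (real J powr (1 - 1 / q) * (\<Sum>j=1..J. ?x j powr q) powr (1 / q))"
        using sum_le_powr_mean[of q "{1..J}" ?x] q b window_const_pos by (intro mult_left_mono) auto
      also have "\<dots> \<le> window_const * b * (real J powr (1 - 1 / q) * (L' * Lp_norm p (trig_sum {1..N} ?neg y)))"
        unfolding P(2)[OF N, symmetric] using b window_const_pos
        by (intro mult_left_mono L'(2) P(1) trig_sum_in_trig_polys) auto
      finally show "norm (\<Sum>k=1..N. (T ^^ k) (y k))
          \<le> window_const * L' * real J powr (1 - 1 / q) * b * Lp_norm p (trig_sum {1..N} ?neg y)"
        by (simp only: mult_ac)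
    qed
  qed
qed

end

section \<open>Solving the square-root recursion\<close>

lemma ln_ge_1: "N \<ge> (1::nat) \<Longrightarrow> 1 \<le> ln (real N + 2)"
  using exp_le by (subst ln_ge_iff) auto

text \<open>
  Each application of the recursion at most multiplies the constant, and the argument drops
  below any fixed bound after \<open>O(log log N)\<close> applications.
\<close>

lemma square_root_recursion:
  fixes Q :: "nat \<Rightarrow> real \<Rightarrow> bool"
  assumes mono: "\<And>N a b. Q N a \<Longrightarrow> a \<le> b \<Longrightarrow> Q N b"
    and ex: "\<And>N. \<exists>a\<ge>0. Q N a"
    and step: "\<And>J N a. 1 \<le> J \<Longrightarrow> N < (Suc J)\<^sup>2 \<Longrightarrow> 0 \<le> a \<Longrightarrow> Q (10 * J) a \<Longrightarrow> Q N (C * real J powr \<alpha> * a)"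
    and C: "C \<ge> 0" and \<alpha>: "\<alpha> \<ge> 0"
  shows "\<exists>D>0. \<exists>\<beta>>0. \<forall>N\<ge>1. Q N (D * real N powr \<alpha> * ln (real N + 2) powr \<beta>)"
proof -
  \<comment> \<open>The loss per step: C, and 10^\<alpha> because the argument is 10J instead of
    J.\<close>
  define E where "E = C * 10 powr \<alpha>"
  have E: "E \<ge> 0" using C by (simp add: E_def)
  \<comment> \<open>One step shrinks the logarithm by a factor 3/4, so \<beta> is taken so large
    that (3/4)^\<beta> absorbs \<open>E\<close>.\<close>
  obtain n where n: "(3/4 :: real) ^ n < 1 / (E + 1)"
    using real_arch_pow_inv[of "1 / (E + 1)" "3/4"] E by auto
  define \<beta> where "\<beta> = real (Suc n)"
  have \<beta>: "\<beta> > 0" by (simp add: \<beta>_def)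
  have "(3/4 :: real) powr \<beta> = (3/4) ^ Suc n" unfolding \<beta>_def by (rule powr_realpow) simp
  also have "\<dots> \<le> (3/4) ^ n" by simp
  also have "\<dots> \<le> 1 / (E + 1)" using n by (rule less_imp_le)
  finally have "E * (3/4) powr \<beta> \<le> E * (1 / (E + 1))" using E by (intro mult_left_mono)
  also have "\<dots> \<le> 1" using E by simp
  finally have E\<beta>: "E * (3/4) powr \<beta> \<le> 1" .
  obtain f where f: "\<And>N. f N \<ge> 0" "\<And>N. Q N (f N)" using ex by metis
  \<comment> \<open>14641 = 121^2 = 11^4: beyond it J \<ge> 121, which gives 10J + 2 \<le> 11J and
    11^4 \<le> J^2. Up to it, D dominates the finitely many given constants.\<close>
  define D where "D = 1 + (\<Sum>N\<le>14641. f N)"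
  have D: "D > 0" unfolding D_def using f(1) by (intro add_pos_nonneg sum_nonneg) auto
  have "Q N (D * real N powr \<alpha> * ln (real N + 2) powr \<beta>)" if "N \<ge> 1" for N
    using that
  proof (induction N rule: less_induct)
    case (less N)
    have l: "1 \<le> ln (real N + 2)" by (rule ln_ge_1[OF less.prems])
    show ?case
    proof (cases "N \<le> 14641")
      case True
      then have "f N \<le> (\<Sum>N\<le>14641. f N)" using f(1) by (intro member_le_sum) auto
      then have "f N \<le> D" by (simp add: D_def)
      also have "D \<le> D * (real N powr \<alpha> * ln (real N + 2) powr \<beta>)"
      proof -
        have "1 \<le> real N powr \<alpha>" using less.prems \<alpha> by (intro ge_one_powr_ge_zero) auto
        moreover have "1 \<le> ln (real N + 2) powr \<beta>" using l \<beta> by (intro ge_one_powr_ge_zero) auto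
        ultimately have "1 * 1 \<le> real N powr \<alpha> * ln (real N + 2) powr \<beta>" by (intro mult_mono) auto
        then show ?thesis using mult_left_mono[of 1 _ D] D by simp
      qed
      finally show ?thesis using mono[OF f(2)[of N]] by (simp add: mult.assoc)
    next
      case False
      define J where "J = floor_sqrt N"
      have J2: "J\<^sup>2 \<le> N" "N < (Suc J)\<^sup>2"
        using Suc_floor_sqrt_power2_gt[of N] by (simp_all add: J_def)
      have J: "J \<ge> 121" unfolding J_def using False by (intro le_floor_sqrtI) simp
      have "10 * J < J\<^sup>2" using J by (simp add: power2_eq_square)
      with J2 have "10 * J < N" by linarith
      moreover have "1 \<le> 10 * J" using J by simp
      ultimately have "Q (10 * J) (D * real (10 * J) powr \<alpha> * ln (real (10 * J) + 2) powr \<beta>)"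
        by (rule less.IH)
      then have "Q N (C * real J powr \<alpha> * (D * real (10 * J) powr \<alpha> * ln (real (10 * J) + 2) powr \<beta>))"
        using J D by (intro step J2(2)) auto
      moreover have "C * real J powr \<alpha> * (D * real (10 * J) powr \<alpha> * ln (real (10 * J) + 2) powr \<beta>)
          \<le> D * real N powr \<alpha> * ln (real N + 2) powr \<beta>"
      proof -
        define X where "X = real J"
        have X: "X \<ge> 121" "X\<^sup>2 \<le> real N"
          using J J2(1) by (simp_all add: X_def flip: of_nat_power)
        have "X powr \<alpha> * X powr \<alpha> = (X\<^sup>2) powr \<alpha>"
          using X by (simp add: power2_eq_square powr_mult)
        also have "\<dots> \<le> real N powr \<alpha>" using X \<alpha> by (intro powr_mono2) auto
        finally have 1: "X powr \<alpha> * X powr \<alpha> \<le> real N powr \<alpha>" .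
        \<comment> \<open>The aim is 10J + 2 \<le> (N + 2)^(3/4), written with integer
          powers.\<close>
        have "(10 * X + 2) ^ 4 \<le> (11 * X) ^ 4" using X by (intro power_mono) auto
        also have "\<dots> = 14641 * X ^ 4" by (simp add: power_mult_distrib)
        also have "\<dots> \<le> X\<^sup>2 * X ^ 4"
        proof (rule mult_right_mono)
          have "121\<^sup>2 \<le> X\<^sup>2" using X by (intro power_mono) auto
          then show "14641 \<le> X\<^sup>2" by simp
        qed simp
        also have "\<dots> = (X\<^sup>2) ^ 3" by (simp flip: power_mult power_add)
        also have "\<dots> \<le> (real N + 2) ^ 3" using X by (intro power_mono) auto
        finally have "ln ((10 * X + 2) ^ 4) \<le> ln ((real N + 2) ^ 3)"
          using X by (subst ln_le_cancel_iff) auto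
        then have "4 * ln (10 * X + 2) \<le> 3 * ln (real N + 2)"
          using X by (simp add: ln_realpow)
        then have "ln (10 * X + 2) powr \<beta> \<le> (3 / 4 * ln (real N + 2)) powr \<beta>"
          using X \<beta> by (intro powr_mono2) auto
        also have "\<dots> = (3/4) powr \<beta> * ln (real N + 2) powr \<beta>"
          using l by (subst powr_mult) auto
        finally have 2: "ln (10 * X + 2) powr \<beta> \<le> (3/4) powr \<beta> * ln (real N + 2) powr \<beta>" .
        have "C * X powr \<alpha> * (D * (10 * X) powr \<alpha> * ln (10 * X + 2) powr \<beta>)
            = D * E * (X powr \<alpha> * X powr \<alpha>) * ln (10 * X + 2) powr \<beta>"
          using X by (simp add: E_def powr_mult)
        also have "\<dots> \<le> D * E * real N powr \<alpha> * ((3/4) powr \<beta> * ln (real N + 2) powr \<beta>)"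
          using 1 2 D E by (intro mult_mono mult_nonneg_nonneg) auto
        also have "\<dots> = D * real N powr \<alpha> * ln (real N + 2) powr \<beta> * (E * (3/4) powr \<beta>)"
          by (simp only: mult_ac)
        also have "\<dots> \<le> D * real N powr \<alpha> * ln (real N + 2) powr \<beta> * 1"
          using E\<beta> D by (intro mult_left_mono mult_nonneg_nonneg) auto
        finally show ?thesis by (simp add: X_def)
      qed
      ultimately show ?thesis by (rule mono)
    qed
  qed
  then show ?thesis using D \<beta> by blast
qed

text \<open>T^n x is averaged over the splittings T^k T^(n-k) with k in {1..j}. Modulation by e_n
  preserves the L^p norm and moves the frequencies -k to n - k, which turns the right-hand side of
  the backward bound into a forward window.\<close>

lemma (in Kreiss_operator) power_bound_from_windows:
  assumes A: "forward_bound (10 * j) a" and B: "backward_bound j b" and b: "b \<ge> 0"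
    and j: "1 \<le> j" and n: "(Suc j)\<^sup>2 \<le> n" "n < (Suc (Suc j))\<^sup>2"
  shows "real j * norm ((T ^^ n) x) \<le> b * (window_const * a * norm x)"
proof -
  have sq: "(Suc j)\<^sup>2 = j\<^sup>2 + 2 * j + 1" "(Suc (Suc j))\<^sup>2 = j\<^sup>2 + 4 * j + 4"
    by (simp_all add: power2_eq_square)
  have jn: "j < n" using n sq by linarith
  have "(\<Sum>k=1..j. (T ^^ k) ((T ^^ (n - k)) x)) = (\<Sum>k=1..j. (T ^^ n) x)"
  proof (rule sum.cong[OF refl])
    fix k assume "k \<in> {1..j}"
    then have "k + (n - k) = n" using jn by auto
    then show "(T ^^ k) ((T ^^ (n - k)) x) = (T ^^ n) x"
      by (metis comp_apply funpow_add)
  qed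
  then have "real j * norm ((T ^^ n) x) = norm (\<Sum>k=1..j. (T ^^ k) ((T ^^ (n - k)) x))"
    by (simp add: sum_constant_scaleR)
  also have "\<dots> \<le> b * Lp_norm p (trig_sum {1..j} (\<lambda>k. - int k) (\<lambda>k. (T ^^ (n - k)) x))"
    by (rule B[unfolded backward_bound_def, rule_format])
  also have "Lp_norm p (trig_sum {1..j} (\<lambda>k. - int k) (\<lambda>k. (T ^^ (n - k)) x))
      = Lp_norm p (trig_sum {n - j..n - 1} int (\<lambda>k. (T ^^ k) x))"
  proof -
    have "trig_sum {n - j..n - 1} int (\<lambda>k. (T ^^ k) x) t
        = trig_char (int n) t *\<^sub>C trig_sum {1..j} (\<lambda>k. - int k) (\<lambda>k. (T ^^ (n - k)) x) t" for t
    proof -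
      have "trig_sum {n - j..n - 1} int (\<lambda>k. (T ^^ k) x) t
          = (\<Sum>k=1..j. trig_char (int (n - k)) t *\<^sub>C (T ^^ (n - k)) x)"
        unfolding trig_sum_def using jn
        by (intro sum.reindex_bij_witness[of _ "\<lambda>k. n - k" "\<lambda>k. n - k"]) auto
      also have "\<dots> = (\<Sum>k=1..j. trig_char (int n) t *\<^sub>C trig_char (- int k) t *\<^sub>C (T ^^ (n - k)) x)"
        using jn by (intro sum.cong) (auto simp: scaleC_scaleC trig_char_add[symmetric] of_nat_diff)
      finally show ?thesis by (simp add: trig_sum_def scaleC.sum_right)
    qed
    then show ?thesis by (simp add: Lp_norm_def norm_scaleC)
  qed
  \<comment> \<open>The window fits: n - j \<ge> j^2 + j + 1, and n - 1 \<le> j^2 + 4j + 2 \<le> j^2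
    + 6j.\<close>
  also have "b * \<dots> \<le> b * (window_const * a * norm x)"
    using n sq b j by (intro mult_left_mono forward_window[OF A j]) auto
  finally show ?thesis .
qed

text \<open>Up to logarithms the forward and backward constants grow like j^(1/q0) and j^(1 - 1/q1).
  Dividing by j leaves j^(1/q0 - 1/q1), and j \<le> sqrt n halves the exponent.\<close>

lemma (in Kreiss_operator) power_growth:
  assumes "1 < q0" and "q0 \<le> q1"
    and upper: "upper_decompositions TYPE('a) q0 p" and lower: "lower_decompositions TYPE('a) q1 p"
  shows "\<exists>C>0. \<exists>\<beta>>0. \<forall>n\<ge>1.
    onorm (T ^^ n) \<le> C * real n powr (1 / 2 * (1 / q0 - 1 / q1)) * ln (real n + 2) powr \<beta>"
proof -
  have q1: "q1 > 1" using assms by simp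
  obtain C0 where C0: "C0 \<ge> 0" "\<And>J N a. J \<ge> 1 \<Longrightarrow> N < (Suc J)\<^sup>2 \<Longrightarrow> 0 \<le> a \<Longrightarrow> forward_bound (10 * J) a
    \<Longrightarrow> forward_bound N (C0 * real J powr (1 / q0) * a)"
    using forward_bound_step[OF upper assms(1)] by blast
  obtain C1 where C1: "C1 \<ge> 0" "\<And>J N b. J \<ge> 1 \<Longrightarrow> N < (Suc J)\<^sup>2 \<Longrightarrow> 0 \<le> b \<Longrightarrow> backward_bound (10 * J) b
    \<Longrightarrow> backward_bound N (C1 * real J powr (1 - 1 / q1) * b)"
    using backward_bound_step[OF lower q1] by blast
  have "\<exists>D>0. \<exists>\<beta>>0. \<forall>N\<ge>1. forward_bound N (D * real N powr (1 / q0) * ln (real N + 2) powr \<beta>)"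
    by (rule square_root_recursion[where C = C0])
       (use forward_bound_mono forward_bound_exists C0 assms in auto)
  then obtain D0 \<beta>0 where D0: "D0 > 0" "\<beta>0 > 0"
    "\<And>N. N \<ge> 1 \<Longrightarrow> forward_bound N (D0 * real N powr (1 / q0) * ln (real N + 2) powr \<beta>0)"
    by blast
  have "\<exists>D>0. \<exists>\<beta>>0. \<forall>N\<ge>1. backward_bound N (D * real N powr (1 - 1 / q1) * ln (real N + 2) powr \<beta>)"
    by (rule square_root_recursion[where C = C1])
       (use backward_bound_mono backward_bound_exists C1 q1 in auto)
  then obtain D1 \<beta>1 where D1: "D1 > 0" "\<beta>1 > 0"
    "\<And>N. N \<ge> 1 \<Longrightarrow> backward_bound N (D1 * real N powr (1 - 1 / q1) * ln (real N + 2) powr \<beta>1)"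
    by blast
  define \<gamma> where "\<gamma> = 1 / 2 * (1 / q0 - 1 / q1)"
  have \<gamma>: "\<gamma> \<ge> 0" using assms by (simp add: \<gamma>_def frac_le)
  define \<beta> where "\<beta> = \<beta>0 + \<beta>1"
  have \<beta>: "\<beta> > 0" using D0 D1 by (simp add: \<beta>_def)
  define C where "C = D1 * window_const * D0 * 10 powr (1 / q0) * 4 powr \<beta>0"
  have C: "C > 0" using D0 D1 window_const_pos by (simp add: C_def)
  \<comment> \<open>Covers n < 4, where the choice of j below would give j = 0.\<close>
  define c where "c = (\<Sum>n<4. onorm (T ^^ n))"
  have on: "onorm (T ^^ n) \<ge> 0" for n by (rule onorm_pos_le[OF bounded_linear_power])
  have c: "c \<ge> 0" unfolding c_def by (intro sum_nonneg on)
  have "onorm (T ^^ n) \<le> (C + c) * real n powr \<gamma> * ln (real n + 2) powr \<beta>" if n: "n \<ge> 1" for n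
  proof -
    have l: "1 \<le> ln (real n + 2)" by (rule ln_ge_1[OF n])
    have "1 \<le> real n powr \<gamma>" using n \<gamma> by (intro ge_one_powr_ge_zero) auto
    moreover have "1 \<le> ln (real n + 2) powr \<beta>" using l \<beta> by (intro ge_one_powr_ge_zero) auto
    ultimately have g1: "1 * 1 \<le> real n powr \<gamma> * ln (real n + 2) powr \<beta>" by (intro mult_mono) auto
    show ?thesis
    proof (cases "n < 4")
      case True
      then have "onorm (T ^^ n) \<le> c"
        unfolding c_def using on by (intro member_le_sum[of n _ "\<lambda>n. onorm (T ^^ n)"]) auto
      also have "c \<le> C + c" using C by simp
      also have "C + c \<le> (C + c) * (real n powr \<gamma> * ln (real n + 2) powr \<beta>)"
        using mult_left_mono[OF g1, of "C + c"] C c by simp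
      finally show ?thesis by (simp add: mult.assoc)
    next
      case False
      \<comment> \<open>One less than the integer square root, so that the j indices below n stay
        above j^2.\<close>
      define j where "j = floor_sqrt n - 1"
      have "2 \<le> floor_sqrt n" using False by (intro le_floor_sqrtI) simp
      then have j: "1 \<le> j" "Suc j = floor_sqrt n" by (auto simp: j_def)
      have jn: "(Suc j)\<^sup>2 \<le> n" "n < (Suc (Suc j))\<^sup>2"
        using Suc_floor_sqrt_power2_gt[of n] by (simp_all add: j(2))
      define X Y where "X = real j" and "Y = real n"
      have X: "X \<ge> 1" using j by (simp add: X_def)
      have "j\<^sup>2 \<le> (Suc j)\<^sup>2" by (intro power_mono) auto
      with jn have "real (j\<^sup>2) \<le> real n" by linarith
      then have XY2: "X\<^sup>2 \<le> Y" by (simp add: X_def Y_def)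
      have "X \<le> X\<^sup>2" using X by (simp add: power2_eq_square)
      then have XY: "X \<le> Y" "1 \<le> Y" using XY2 X by linarith+
      define a where "a = D0 * (10 * X) powr (1 / q0) * ln (10 * X + 2) powr \<beta>0"
      define b where "b = D1 * X powr (1 - 1 / q1) * ln (X + 2) powr \<beta>1"
      have A: "forward_bound (10 * j) a" using D0(3)[of "10 * j"] j by (simp add: a_def X_def)
      have B: "backward_bound j b" using D1(3)[of j] j by (simp add: b_def X_def)
      have ab: "a \<ge> 0" "b \<ge> 0" using D0 D1 by (auto simp: a_def b_def)
      have pw: "norm ((T ^^ n) x) \<le> (b * window_const * a / X) * norm x" for x
        using power_bound_from_windows[OF A B ab(2) j(1) jn, of x] X
        by (simp add: X_def pos_le_divide_eq mult_ac)
      have "onorm (T ^^ n) \<le> b * window_const * a / X"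
        using ab window_const_pos X by (intro onorm_bound pw) auto
      also have "\<dots> \<le> C * (Y powr \<gamma> * ln (Y + 2) powr \<beta>)"
      proof -
        have l0: "ln (10 * X + 2) powr \<beta>0 \<le> 4 powr \<beta>0 * ln (Y + 2) powr \<beta>0"
        proof -
          \<comment> \<open>Crude comparison 10X + 2 \<le> (Y + 2)^4, where 27 = 3^3 \<le> (Y +
            2)^3; the exponent 4 is the origin of 4^\<beta>0 in \<open>C\<close>.\<close>
          have "10 * X + 2 \<le> 27 * (Y + 2)" using XY by simp
          also have "\<dots> \<le> (Y + 2) ^ 3 * (Y + 2)"
          proof (rule mult_right_mono)
            have "3 ^ 3 \<le> (Y + 2) ^ 3" using XY by (intro power_mono) auto
            then show "27 \<le> (Y + 2) ^ 3" by simp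
          qed (use XY in auto)
          also have "\<dots> = (Y + 2) ^ 4" by (simp add: eval_nat_numeral)
          finally have "ln (10 * X + 2) \<le> ln ((Y + 2) ^ 4)" using X XY by (subst ln_le_cancel_iff) auto
          then have "ln (10 * X + 2) \<le> 4 * ln (Y + 2)" using XY by (simp add: ln_realpow)
          then have "ln (10 * X + 2) powr \<beta>0 \<le> (4 * ln (Y + 2)) powr \<beta>0"
            using X D0 by (intro powr_mono2) auto
          then show ?thesis using XY by (simp add: powr_mult)
        qed
        have l1: "ln (X + 2) powr \<beta>1 \<le> ln (Y + 2) powr \<beta>1"
          using X XY D1 by (intro powr_mono2) auto
        have "X powr (1 / q0) * X powr (1 - 1 / q1) / X = X powr (1 / q0 + (1 - 1 / q1) - 1)"
          using X by (simp add: powr_diff powr_add)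
        also have "1 / q0 + (1 - 1 / q1) - 1 = 2 * \<gamma>" by (simp add: \<gamma>_def)
        also have "X powr (2 * \<gamma>) = (X\<^sup>2) powr \<gamma>"
          using X by (simp add: powr_powr flip: powr_numeral)
        also have "\<dots> \<le> Y powr \<gamma>" using XY2 \<gamma> by (intro powr_mono2) auto
        finally have xx: "X powr (1 / q0) * X powr (1 - 1 / q1) / X \<le> Y powr \<gamma>" .
        have "b * window_const * a / X = D1 * window_const * D0 * 10 powr (1 / q0)
            * (X powr (1 / q0) * X powr (1 - 1 / q1) / X)
            * (ln (10 * X + 2) powr \<beta>0 * ln (X + 2) powr \<beta>1)"
          using X by (simp add: a_def b_def powr_mult)
        also have "\<dots> \<le> D1 * window_const * D0 * 10 powr (1 / q0) * Y powr \<gamma>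
            * ((4 powr \<beta>0 * ln (Y + 2) powr \<beta>0) * ln (Y + 2) powr \<beta>1)"
          using xx l0 l1 D0(1) D1(1) window_const_pos X by (intro mult_mono mult_nonneg_nonneg) auto
        also have "\<dots> = C * (Y powr \<gamma> * ln (Y + 2) powr \<beta>)"
          by (simp add: C_def \<beta>_def powr_add)
        finally show ?thesis .
      qed
      also have "\<dots> \<le> (C + c) * (Y powr \<gamma> * ln (Y + 2) powr \<beta>)"
        using c by (intro mult_right_mono) auto
      finally show ?thesis by (simp add: Y_def mult.assoc)
    qed
  qed
  then show ?thesis using C c \<beta> unfolding \<gamma>_def by (intro exI[of _ "C + c"] exI[of _ \<beta>] conjI allI impI) auto
qed

theorem theorem1p1:
  fixes T :: "'a::complex_banach \<Rightarrow> 'a" and p q0 q1 :: real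
  assumes "1 < p" and "1 < q0" and "q0 \<le> q1"
    and "upper_decompositions TYPE('a) q0 p"
    and "lower_decompositions TYPE('a) q1 p"
    and "bounded_clinear T"
    and "strongly_Kreiss_bounded T"
  shows "\<exists>C>0. \<exists>\<beta>>0. \<forall>n\<ge>1.
    onorm (T ^^ n) \<le> C * real n powr (1 / 2 * (1 / q0 - 1 / q1)) * ln (real n + 2) powr \<beta>"
proof -
  obtain K where K: "strongly_Kreiss_bounded_with K T"
    using assms(7) unfolding strongly_Kreiss_bounded_def by blast
  obtain L where L: "bounded_freq_proj TYPE('a) p L"
    using lower_decompositions_imp_bounded_freq_proj[OF assms(5)] assms by auto
  interpret Kreiss_operator T K p L
    using K L assms by unfold_locales auto
  show ?thesis by (rule power_growth[OF assms(2-5)])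
qed

end
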